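(* Let $(X,\Gamma)$ be a topological dynamical system, where $\Gamma$ is a nilpotent group such that for each $T\in\Gamma$ with $T\neq e_\Gamma$ the system $(X,T)$ is weakly mixing and minimal. Let $d,k\in\mathbb{N}$, let $T_1,\ldots,T_d\in\Gamma$, and let $p_{i,j}\in\mathcal{P}_0$ for $1\le i\le k$, $1\le j\le d$. For $i=1,\ldots,k$ and $n\in\mathbb{Z}$ put $$g_i(n)=T_1^{p_{i,1}(n)}\cdots T_d^{p_{i,d}(n)}.$$ Assume that $g_i(n)$ depends nontrivially on $n$ for each $i=1,\ldots,k$, and that $g_i(n)g_j(n)^{-1}$ depends nontrivially on $n$ for all $i\neq j$ in $\{1,\ldots,k\}$. Then for all non-empty open sets $U, U_1,\ldots,U_k, V_1,\ldots,V_k$ of $X$, the set $$\{n\in\mathbb{Z}: (U_1\times\cdots\times U_k)\cap (g_1(n)^{-1}\times\cdots\times g_k(n)^{-1})(V_1\times\cdots\times V_k)\neq\emptyset\}$$ is thickly-syndetic, and the set $$\{n\in\mathbb{Z}: U\cap g_1(n)^{-1}V_1\cap\cdots\cap g_k(n)^{-1}V_k\neq\emptyset\}$$ is syndetic.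
   Context: A topological dynamical system $(X,\Gamma)$ consists of a compact metric space $X$ and a Hausdorff topological group $\Gamma$ with unit $e_\Gamma$ acting on $X$ by a continuous action map $\Gamma\times X\to X$. For $T\in\Gamma$, $(X,T)$ denotes the $\mathbb{Z}$-action on $X$ generated by $T$. A system is minimal if $X$ contains no proper non-empty closed invariant subset; it is transitive if every non-empty invariant open subset is dense; it is weakly mixing if the product system $X\times X$ (with the diagonal action) is transitive. $\mathcal{P}_0$ is the set of polynomials $p$ with rational coefficients taking integer values on the integers and with $p(0)=0$. A map $g:\mathbb{Z}\to\Gamma$ "depends nontrivially on $n$" if it is a nonconstant map. A set $S\subseteq\mathbb{Z}$ is syndetic if there is $N\in\mathbb{N}$ with $\{i,i+1,\ldots,i+N\}\cap S\neq\emptyset$ for every $i\in\mathbb{Z}$. $S$ is thickly-syndetic if for every $N\in\mathbb{N}$ the set of positions where length-$N$ runs of consecutive integers contained in $S$ begin, i.e. $\{n\in\mathbb{Z}:\{n,n+1,\ldots,n+N-1\}\subseteq S\}$, is syndetic. $\mathbb{N}$ is the set of positive integers. *)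

theory Defs
  imports
    "HOL-Analysis.Analysis"
    "HOL-Algebra.Generated_Groups"
    "HOL-Algebra.Group_Action"
    "HOL-Algebra.Elementary_Groups"
    "HOL-Computational_Algebra.Polynomial"
begin

primrec lower_central_series :: "('g, 'b) monoid_scheme \<Rightarrow> nat \<Rightarrow> 'g set" where
  "lower_central_series G 0 = carrier G"
| "lower_central_series G (Suc n) =
     generate G {h \<otimes>\<^bsub>G\<^esub> g \<otimes>\<^bsub>G\<^esub> inv\<^bsub>G\<^esub> h \<otimes>\<^bsub>G\<^esub> inv\<^bsub>G\<^esub> g | h g.
                   h \<in> lower_central_series G n \<and> g \<in> carrier G}"

definition nilpotent_group :: "('g, 'b) monoid_scheme \<Rightarrow> bool" where
  "nilpotent_group G \<longleftrightarrow> group G \<and> (\<exists>n. lower_central_series G n = {\<one>\<^bsub>G\<^esub>})"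

locale hausdorff_topological_group = group G
  for G :: "('g, 'b) monoid_scheme" (structure) +
  fixes \<tau> :: "'g topology"
  assumes topspace_eq: "topspace \<tau> = carrier G"
    and hausdorff: "Hausdorff_space \<tau>"
    and continuous_mult: "continuous_map (prod_topology \<tau> \<tau>) \<tau> (\<lambda>(g, h). g \<otimes> h)"
    and continuous_inv: "continuous_map \<tau> \<tau> (\<lambda>g. inv g)"

text \<open>The compact metric space is the whole type \<^typ>\<open>'x\<close>.\<close>

locale topological_dynamical_system =
  hausdorff_topological_group G \<tau> + group_action G "UNIV :: 'x set" \<phi>
  for G :: "('g, 'b) monoid_scheme" (structure)
    and \<tau> :: "'g topology"
    and \<phi> :: "'g \<Rightarrow> 'x::metric_space \<Rightarrow> 'x" +
  assumes compact_space_UNIV: "compact (UNIV :: 'x set)"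
    and continuous_action:
      "continuous_map (prod_topology \<tau> euclidean) euclidean (\<lambda>(g, x). \<phi> g x)"

definition invariant_subset :: "('g, 'b) monoid_scheme \<Rightarrow> ('g \<Rightarrow> 'x \<Rightarrow> 'x) \<Rightarrow> 'x set \<Rightarrow> bool" where
  "invariant_subset G \<phi> A \<longleftrightarrow> (\<forall>g\<in>carrier G. \<phi> g ` A \<subseteq> A)"

definition minimal_system ::
    "('g, 'b) monoid_scheme \<Rightarrow> ('g \<Rightarrow> 'x::topological_space \<Rightarrow> 'x) \<Rightarrow> bool" where
  "minimal_system G \<phi> \<longleftrightarrow>
     \<not> (\<exists>A. A \<subset> UNIV \<and> A \<noteq> {} \<and> closed A \<and> invariant_subset G \<phi> A)"

definition transitive_system ::
    "('g, 'b) monoid_scheme \<Rightarrow> ('g \<Rightarrow> 'x::topological_space \<Rightarrow> 'x) \<Rightarrow> bool" where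
  "transitive_system G \<phi> \<longleftrightarrow>
     (\<forall>U. U \<noteq> {} \<and> open U \<and> invariant_subset G \<phi> U \<longrightarrow> closure U = UNIV)"

definition diagonal_action :: "('g \<Rightarrow> 'x \<Rightarrow> 'x) \<Rightarrow> 'g \<Rightarrow> 'x \<times> 'x \<Rightarrow> 'x \<times> 'x" where
  "diagonal_action \<phi> g = map_prod (\<phi> g) (\<phi> g)"

definition weakly_mixing_system ::
    "('g, 'b) monoid_scheme \<Rightarrow> ('g \<Rightarrow> 'x::topological_space \<Rightarrow> 'x) \<Rightarrow> bool" where
  "weakly_mixing_system G \<phi> \<longleftrightarrow> transitive_system G (diagonal_action \<phi>)"

text \<open>The \<open>\<int>\<close>-action generated by \<open>t\<close>; the acting group is \<^const>\<open>integer_group\<close>.\<close>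

definition generated_action ::
    "('g, 'b) monoid_scheme \<Rightarrow> ('g \<Rightarrow> 'x \<Rightarrow> 'x) \<Rightarrow> 'g \<Rightarrow> int \<Rightarrow> 'x \<Rightarrow> 'x" where
  "generated_action G \<phi> t n = \<phi> (t [^]\<^bsub>G\<^esub> n)"

definition integral_polys_0 :: "rat poly set" where
  "integral_polys_0 = {p. (\<forall>n::int. poly p (of_int n) \<in> \<int>) \<and> poly p 0 = 0}"

text \<open>The ordered product \<open>T\<^sub>1\<^bsup>q\<^sub>1(n)\<^esup> \<cdots> T\<^sub>d\<^bsup>q\<^sub>d(n)\<^esup>\<close>. The floor only converts the
  type: it is exact for members of \<^const>\<open>integral_polys_0\<close>.\<close>

definition polynomial_product ::
    "('g, 'b) monoid_scheme \<Rightarrow> nat \<Rightarrow> (nat \<Rightarrow> 'g) \<Rightarrow> (nat \<Rightarrow> rat poly) \<Rightarrow> int \<Rightarrow> 'g" where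
  "polynomial_product G d T q n =
     foldr (\<otimes>\<^bsub>G\<^esub>) (map (\<lambda>j. T j [^]\<^bsub>G\<^esub> \<lfloor>poly (q j) (of_int n)\<rfloor>) [1..<Suc d]) \<one>\<^bsub>G\<^esub>"

definition depends_nontrivially :: "(int \<Rightarrow> 'g) \<Rightarrow> bool" where
  "depends_nontrivially g \<longleftrightarrow> \<not> g constant_on UNIV"

definition syndetic :: "int set \<Rightarrow> bool" where
  "syndetic S \<longleftrightarrow> (\<exists>N::nat. N \<ge> 1 \<and> (\<forall>i. {i..i + int N} \<inter> S \<noteq> {}))"

definition thickly_syndetic :: "int set \<Rightarrow> bool" where
  "thickly_syndetic S \<longleftrightarrow> (\<forall>N::nat. N \<ge> 1 \<longrightarrow> syndetic {n. {n..n + int N - 1} \<subseteq> S})"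

end

theory Submission
  imports Defs "HOL-Algebra.Product_Groups"
begin

text \<open>
  Sequences \<open>n \<mapsto> T\<^sub>1\<^bsup>q\<^sub>1(n)\<^esup> \<cdots> T\<^sub>d\<^bsup>q\<^sub>d(n)\<^esup>\<close> generate a group of polynomial sequences. Giving the
  sequence \<open>S\<^bsup>q(n)\<^esup>\<close> the weight \<open>D - deg q\<close> and an iterated commutator the sum of the weights of
  its entries yields a finite normal series such that
  \<open>f(k)\<^sup>-\<^sup>1 f(n + k) \<equiv> f(n)\<close> modulo the term after the last one containing \<open>f\<close>. This is
  all that PET induction needs: for a finite set \<open>A\<close> of sequences and a deepest \<open>a \<in> A\<close>, the
  sequences \<open>f(k)\<^sup>-\<^sup>1 f(n + k) a(n)\<^sup>-\<^sup>1\<close> with \<open>f \<in> A\<close> meet lexicographically fewer cosets.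

  By minimality a central \<open>z \<noteq> 1\<close> has \<open>U, z U, \<dots>, z\<^bsup>m-1\<^esup> U\<close> covering the space. Given shifts
  \<open>k\<^sub>0, \<dots>, k\<^bsub>m-1\<^esub>\<close>, the induction hypothesis supplies syndetically many \<open>n\<close> and a point
  \<open>y\<close> with \<open>f(n + k\<^sub>j) z\<^bsup>-j\<^esup> y\<close> in the target of \<open>f\<close> for all \<open>j\<close> and \<open>f\<close>, and some
  \<open>z\<^bsup>-j\<^esup> y\<close> lies in \<open>U\<close>. Distinct shifts of \<open>f\<close> can only collide when \<open>f(n) = r\<^sup>n\<close>; for these,
  weak mixing makes the sets of return times thickly syndetic, so that the shifts can be
  chosen compatibly. Finally, thick syndeticity for a single \<open>f\<close> not of the form \<open>r\<^sup>n\<close> is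
  syndeticity for its distinct shifts.
\<close>

section \<open>Integer-valued polynomials through iterated differences\<close>

text \<open>\<open>int_polys_below m\<close> consists of the polynomials of degree less than \<open>m\<close>, given by their
  vanishing \<open>m\<close>-fold differences.\<close>

primrec int_polys_below :: "nat \<Rightarrow> (int \<Rightarrow> int) set" where
  "int_polys_below 0 = {\<lambda>_. 0}"
| "int_polys_below (Suc m) = {q. \<forall>k. (\<lambda>n. q (n + k) - q n) \<in> int_polys_below m}"

lemma zero_in_int_polys_below: "(\<lambda>_. 0) \<in> int_polys_below m"
  by (induction m) auto

lemma const_in_int_polys_below: "(\<lambda>_. c) \<in> int_polys_below (Suc m)"
  using zero_in_int_polys_below by auto

lemma uminus_in_int_polys_below:
  "q \<in> int_polys_below m \<Longrightarrow> (\<lambda>n. - q n) \<in> int_polys_below m"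
proof (induction m arbitrary: q)
  case (Suc m)
  have "(\<lambda>n. - (q (n + k) - q n)) \<in> int_polys_below m" for k
    using Suc(2) by (intro Suc.IH) simp
  then show ?case by (simp add: algebra_simps)
qed simp

lemma shift_in_int_polys_below:
  "q \<in> int_polys_below m \<Longrightarrow> (\<lambda>n. q (n + k)) \<in> int_polys_below m"
proof (induction m arbitrary: q)
  case (Suc m)
  have "(\<lambda>n. q (n + k + l) - q (n + k)) \<in> int_polys_below m" for l
    using Suc(1)[of "\<lambda>n. q (n + l) - q n"] Suc(2) by simp
  then show ?case by (simp add: ac_simps)
qed simp

lemma eval_in_int_polys_below:
  "q \<in> int_polys_below m \<Longrightarrow> (\<lambda>_. q k) \<in> int_polys_below m"
  using zero_in_int_polys_below by (cases m) auto

lemma difference_in_int_polys_below: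
  assumes "q \<in> int_polys_below m"
  shows "(\<lambda>n. q (n + k) - q n) \<in> int_polys_below (m - 1)"
  using assms zero_in_int_polys_below by (cases m) auto

lemma degree_shift_diff_less:
  fixes p :: "rat poly"
  assumes "degree p > 0"
  shows "degree (p \<circ>\<^sub>p [:c, 1:] - p) < degree p"
proof -
  have 1: "degree (p \<circ>\<^sub>p [:c, 1:]) = degree p"
    by (simp add: degree_pcompose)
  have "lead_coeff (p \<circ>\<^sub>p [:c, 1:]) = lead_coeff p"
    by (subst lead_coeff_comp) auto
  then have "coeff (p \<circ>\<^sub>p [:c, 1:] - p) (degree p) = 0"
    using 1 by simp
  moreover have "degree (p \<circ>\<^sub>p [:c, 1:] - p) \<le> degree p"
    using 1 by (intro degree_diff_le) auto
  ultimately show ?thesis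
    using assms by (metis eq_zero_or_degree_less degree_0)
qed

text \<open>Induction on the degree bound: the leading coefficients of \<open>p\<close> and its
  shift cancel, so each difference loses a degree; a constant has difference zero. The index is
  \<open>Suc m\<close> because membership bounds the degree strictly.\<close>

lemma poly_in_int_polys_below:
  fixes p :: "rat poly"
  assumes "\<And>n. of_int (z n) = poly p (of_int n)" and "degree p \<le> m"
  shows "z \<in> int_polys_below (Suc m)"
  using assms
proof (induction m arbitrary: p z)
  case 0
  then obtain c where "p = [:c:]"
    by (metis degree_eq_zeroE le_zero_eq)
  then have "of_int (z n) = c" for n
    using 0 by simp
  then have "z n = z 0" for n
    by (metis of_int_eq_iff)
  then show ?case by (metis (full_types) const_in_int_polys_below ext)
next
  case (Suc m)
  have "(\<lambda>n. z (n + k) - z n) \<in> int_polys_below (Suc m)" for k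
  proof (rule Suc.IH)
    show "of_int (z (n + k) - z n) = poly (p \<circ>\<^sub>p [:of_int k, 1:] - p) (of_int n)" for n
      using Suc.prems(1) by (simp add: poly_pcompose add.commute)
    show "degree (p \<circ>\<^sub>p [:of_int k, 1:] - p) \<le> m"
    proof (cases "degree p = 0")
      case True
      then obtain c where "p = [:c:]"
        by (metis degree_eq_zeroE)
      then show ?thesis by simp
    qed (use degree_shift_diff_less[of p "of_int k"] Suc.prems(2) in simp)
  qed
  then show ?case by simp
qed

subsection \<open>Commutators of weighted generators\<close>

definition seq_group :: "('g, 'b) monoid_scheme \<Rightarrow> (int \<Rightarrow> 'g) monoid" where
  "seq_group G = product_group UNIV (\<lambda>_. G)"

context group
begin

lemma group_seq_group: "group (seq_group G)"
  by (simp add: seq_group_def group_axioms)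

lemma carrier_seq_group: "f \<in> carrier (seq_group G) \<longleftrightarrow> (\<forall>n. f n \<in> carrier G)"
  by (auto simp: seq_group_def)

lemma mult_seq_group: "f \<otimes>\<^bsub>seq_group G\<^esub> h = (\<lambda>n. f n \<otimes> h n)"
  by (simp add: seq_group_def restrict_UNIV)

lemma one_seq_group: "\<one>\<^bsub>seq_group G\<^esub> = (\<lambda>_. \<one>)"
  by (simp add: seq_group_def restrict_UNIV)

lemma inv_seq_group:
  "f \<in> carrier (seq_group G) \<Longrightarrow> inv\<^bsub>seq_group G\<^esub> f = (\<lambda>n. inv (f n))"
  using inv_product_group[of f UNIV "\<lambda>_. G"] by (simp add: seq_group_def restrict_UNIV group_axioms)

lemma inv_cancel_left:
  assumes "x \<in> carrier G" "y \<in> carrier G"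
  shows "x \<otimes> (inv x \<otimes> y) = y" and "inv x \<otimes> (x \<otimes> y) = y"
  using assms by (simp_all flip: m_assoc)

lemmas word_simps = m_assoc inv_mult_group inv_cancel_left

definition commutator :: "'a \<Rightarrow> 'a \<Rightarrow> 'a" where
  "commutator x y = x \<otimes> y \<otimes> inv x \<otimes> inv y"

lemma commutator_closed [simp]:
  "x \<in> carrier G \<Longrightarrow> y \<in> carrier G \<Longrightarrow> commutator x y \<in> carrier G"
  by (simp add: commutator_def)

text \<open>The recursion runs in both directions from 0. It serves to recognise a sequence as a
  sequence of powers once its successive quotients are known to be constant.\<close>

lemma int_power_recursion:
  assumes f: "\<And>n::int. f n \<in> carrier G" and c: "c \<in> carrier G"
    and step: "\<And>n. f (n + 1) = c \<otimes> f n"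
  shows "f n = c [^] n \<otimes> f 0"
proof (induction n rule: int_induct[where k = 0])
  case base
  then show ?case using f by simp
next
  case (step1 i)
  have "c [^] (1 + i) = c \<otimes> c [^] i"
    using c by (subst int_pow_mult) (auto simp: int_pow_1)
  then show ?case
    using step1 c f assms(3)[of i] by (simp add: m_assoc add.commute[of i])
next
  case (step2 i)
  have "c [^] (1 + (i - 1)) = c \<otimes> c [^] (i - 1)"
    using c by (subst int_pow_mult) (auto simp: int_pow_1)
  then have "c \<otimes> f (i - 1) = c \<otimes> (c [^] (i - 1) \<otimes> f 0)"
    using step2 c f assms(3)[of "i - 1"] by (simp add: m_assoc)
  then show ?case using c f by simp
qed

lemma int_pow_commute:
  assumes z: "z \<in> carrier G" and g: "g \<in> carrier G" and comm: "z \<otimes> g = g \<otimes> z"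
  shows "z [^] (i::int) \<otimes> g = g \<otimes> z [^] i"
proof -
  have "g \<otimes> z [^] (n + 1) = z \<otimes> (g \<otimes> z [^] n)" for n :: int
  proof -
    have "g \<otimes> z [^] (1 + n) = g \<otimes> z \<otimes> z [^] n"
      using g z by (simp add: int_pow_mult int_pow_1 m_assoc)
    then show ?thesis using g z by (simp add: add.commute m_assoc flip: comm)
  qed
  then have "g \<otimes> z [^] i = z [^] i \<otimes> (g \<otimes> z [^] (0::int))"
    using g z by (intro int_power_recursion) auto
  then show ?thesis using g z by simp
qed

lemma lower_central_series_subset: "lower_central_series G n \<subseteq> carrier G"
proof (induction n)
  case (Suc n)
  show ?case
    unfolding lower_central_series.simps by (rule generate_incl) (use Suc in \<open>auto simp: subset_iff\<close>)
qed simp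

lemma one_in_lower_central_series: "\<one> \<in> lower_central_series G n"
  by (cases n) (auto intro: generate.one)

lemma commutator_in_lower_central_series:
  "x \<in> lower_central_series G n \<Longrightarrow> y \<in> carrier G \<Longrightarrow>
     commutator x y \<in> lower_central_series G (Suc n)"
  unfolding lower_central_series.simps commutator_def by (rule generate.incl) blast

lemma lower_central_series_trivial_mono:
  assumes "lower_central_series G s = {\<one>}" and "s \<le> n"
  shows "lower_central_series G n = {\<one>}"
  using assms(2)
proof (induction n rule: dec_induct)
  case (step n)
  have "{h \<otimes> g \<otimes> inv h \<otimes> inv g | h g. h \<in> lower_central_series G n \<and> g \<in> carrier G} \<subseteq> {\<one>}"
    unfolding step.IH by auto
  then have "{h \<otimes> g \<otimes> inv h \<otimes> inv g | h g. h \<in> lower_central_series G n \<and> g \<in> carrier G} \<in> {{}, {\<one>}}"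
    by (simp only: subset_singleton_iff insert_iff empty_iff simp_thms)
  then show ?case
    by (auto simp only: lower_central_series.simps insert_iff empty_iff generate_one generate_empty)
qed (rule assms(1))

end

text \<open>Any nontrivial element of the last nontrivial term of the lower central series will do:
  its commutators lie in the next term, which is trivial. The element \<open>t\<close> rules out
  that the first term is already trivial.\<close>

lemma nilpotent_group_central_element:
  fixes G (structure)
  assumes "nilpotent_group G" and "t \<in> carrier G" "t \<noteq> \<one>\<^bsub>G\<^esub>"
  obtains z where "z \<in> carrier G" "z \<noteq> \<one>\<^bsub>G\<^esub>"
    "\<And>g. g \<in> carrier G \<Longrightarrow> z \<otimes>\<^bsub>G\<^esub> g = g \<otimes>\<^bsub>G\<^esub> z"
proof -
  interpret group G
    using assms(1) by (simp add: nilpotent_group_def)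
  define s where "s = (LEAST s. lower_central_series G s = {\<one>})"
  have s: "lower_central_series G s = {\<one>}"
    unfolding s_def by (rule LeastI_ex) (use assms(1) in \<open>simp add: nilpotent_group_def\<close>)
  with assms(2,3) obtain m where m: "s = Suc m"
    by (cases s) auto
  have "lower_central_series G m \<noteq> {\<one>}"
    by (rule not_less_Least) (simp add: m flip: s_def)
  then obtain z where z: "z \<in> lower_central_series G m" "z \<noteq> \<one>"
    using one_in_lower_central_series[of m] by (metis subsetI subset_singletonD empty_iff singleton_iff)
  have zc: "z \<in> carrier G"
    using z lower_central_series_subset by blast
  have "z \<otimes> g = g \<otimes> z" if g: "g \<in> carrier G" for g
  proof -
    have "commutator z g = \<one>"
      using commutator_in_lower_central_series[OF z(1) g] s m by simp
    then have "z \<otimes> g = \<one> \<otimes> (g \<otimes> z)"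
      using zc g unfolding commutator_def
      by (metis inv_closed inv_solve_right m_assoc m_closed l_one)
    then show ?thesis using zc g by simp
  qed
  then show thesis
    using that zc z(2) by blast
qed

section \<open>The filtration of a group by the weights of commutators\<close>

locale weighted_generators = group G for G (structure) +
  fixes X :: "nat \<Rightarrow> 'a set"
  assumes gen_closed: "h \<in> X a \<Longrightarrow> h \<in> carrier G"
    and gen_inv: "h \<in> X a \<Longrightarrow> inv h \<in> X a"
begin

text \<open>The two indices have separate uses: \<open>i\<close> counts the brackets and so gives
  the depth in the lower central series, while \<open>u\<close> adds up the weights of the
  \<open>i + 1\<close> entries and decides the level.\<close>

inductive left_normed :: "nat \<Rightarrow> nat \<Rightarrow> 'a \<Rightarrow> bool" where
  base: "h \<in> X a \<Longrightarrow> left_normed 0 a h"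
| step: "left_normed i u x \<Longrightarrow> h \<in> X a \<Longrightarrow> left_normed (Suc i) (u + a) (commutator x h)"

definition level :: "nat \<Rightarrow> 'a set" where
  "level w = generate G {x. \<exists>i u. w \<le> u \<and> left_normed i u x}"

lemma left_normed_closed: "left_normed i u x \<Longrightarrow> x \<in> carrier G"
  by (induction rule: left_normed.induct) (auto intro: gen_closed commutator_closed)

lemma subgroup_level: "subgroup (level w) G"
  unfolding level_def by (rule generate_is_subgroup) (auto intro: left_normed_closed)

lemma level_closed: "x \<in> level w \<Longrightarrow> x \<in> carrier G"
  using subgroup.mem_carrier[OF subgroup_level] .

lemmas level_mult = subgroup.m_closed[OF subgroup_level]
lemmas level_one = subgroup.one_closed[OF subgroup_level]
lemmas level_inv = subgroup.m_inv_closed[OF subgroup_level]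

lemma level_antimono: "v \<le> w \<Longrightarrow> level w \<subseteq> level v"
  unfolding level_def by (rule mono_generate) (use order_trans in blast)

lemma left_normed_in_level: "left_normed i u x \<Longrightarrow> w \<le> u \<Longrightarrow> x \<in> level w"
  unfolding level_def by (rule generate.incl) blast

lemma gen_in_level: "h \<in> X a \<Longrightarrow> h \<in> level a"
  using left_normed.base left_normed_in_level by blast

lemma level_induct [consumes 1, case_names one left_normed inv mult]:
  assumes "x \<in> level w" and "P \<one>"
    and "\<And>x i u. left_normed i u x \<Longrightarrow> w \<le> u \<Longrightarrow> P x"
    and "\<And>x. x \<in> level w \<Longrightarrow> P x \<Longrightarrow> P (inv x)"
    and "\<And>x y. x \<in> level w \<Longrightarrow> y \<in> level w \<Longrightarrow> P x \<Longrightarrow> P y \<Longrightarrow> P (x \<otimes> y)"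
  shows "P x"
proof -
  have "x \<in> level w \<and> P x"
    using assms(1) unfolding level_def
  proof (induction rule: generate.induct)
    case one
    then show ?case using assms(2) level_one level_def by simp
  next
    case (incl h)
    then show ?case using assms(3) left_normed_in_level level_def by auto
  next
    case (inv h)
    then have "h \<in> level w" "P h"
      using assms(3) left_normed_in_level by auto
    then show ?case using assms(4) level_inv level_def by auto
  next
    case (eng h1 h2)
    then show ?case using assms(5) level_mult level_def by auto
  qed
  then show ?thesis ..
qed

text \<open>On a left-normed commutator \<open>x\<close>, conjugation by \<open>h\<close> is
  multiplication by the inverse of the commutator of \<open>x\<close> and \<open>h\<close>, which is
  again left-normed and weighs at least as much.\<close>

lemma gen_conj_in_level:
  assumes "x \<in> level w" and h: "h \<in> X a"
  shows "h \<otimes> x \<otimes> inv h \<in> level w"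
proof -
  have hc: "h \<in> carrier G" using gen_closed h by blast
  show ?thesis
    using assms(1)
  proof (induction rule: level_induct)
    case one
    then show ?case using hc level_one by simp
  next
    case (left_normed x i u)
    have xc: "x \<in> carrier G" using left_normed left_normed_closed by blast
    have "inv (commutator x h) \<otimes> x \<in> level w"
      using left_normed h left_normed.step[of i u x h a]
      by (intro level_mult level_inv) (auto intro: left_normed_in_level)
    moreover have "inv (commutator x h) \<otimes> x = h \<otimes> x \<otimes> inv h"
      using xc hc by (simp add: commutator_def word_simps)
    ultimately show ?case by simp
  next
    case (inv x)
    have "inv (h \<otimes> x \<otimes> inv h) = h \<otimes> inv x \<otimes> inv h"
      using inv hc level_closed by (simp add: word_simps)
    then show ?case using inv level_inv by metis
  next
    case (mult x y)
    have "(h \<otimes> x \<otimes> inv h) \<otimes> (h \<otimes> y \<otimes> inv h) = h \<otimes> (x \<otimes> y) \<otimes> inv h"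
      using mult hc level_closed by (simp add: word_simps)
    then show ?case using mult level_mult by metis
  qed
qed

text \<open>The elements that conjugate \<open>level w\<close> into itself form a group containing
  all generators, hence all of \<open>level 0\<close>. Asking for conjugation in both directions
  makes closure under inverses immediate.\<close>

lemma level_conj:
  assumes "x \<in> level 0" "y \<in> level w"
  shows "x \<otimes> y \<otimes> inv x \<in> level w"
proof -
  define N where "N = {x \<in> carrier G. \<forall>y\<in>level w. x \<otimes> y \<otimes> inv x \<in> level w \<and> inv x \<otimes> y \<otimes> x \<in> level w}"
  have N_mult: "x \<otimes> x' \<in> N" if x: "x \<in> N" "x' \<in> N" for x x'
  proof -
    have c: "x \<in> carrier G" "x' \<in> carrier G" using x by (auto simp: N_def)
    have "x \<otimes> x' \<otimes> y \<otimes> inv (x \<otimes> x') \<in> level w" if y: "y \<in> level w" for y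
    proof -
      have "x \<otimes> (x' \<otimes> y \<otimes> inv x') \<otimes> inv x \<in> level w"
        using x y by (simp add: N_def)
      then show ?thesis using c level_closed[OF y] by (simp add: word_simps)
    qed
    moreover have "inv (x \<otimes> x') \<otimes> y \<otimes> (x \<otimes> x') \<in> level w" if y: "y \<in> level w" for y
    proof -
      have "inv x' \<otimes> (inv x \<otimes> y \<otimes> x) \<otimes> x' \<in> level w"
        using x y by (simp add: N_def)
      then show ?thesis using c level_closed[OF y] by (simp add: word_simps)
    qed
    ultimately show ?thesis using c by (simp add: N_def)
  qed
  have N_inv: "inv x \<in> N" if "x \<in> N" for x
    using that by (simp add: N_def)
  have N_gen: "h \<in> N" if "h \<in> X a" for h a
    using gen_conj_in_level[OF _ that] gen_conj_in_level[OF _ gen_inv[OF that]] gen_closed[OF that]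
    by (simp add: N_def)
  have N_left_normed: "x \<in> N" if "left_normed i u x" for x i u
    using that
  proof (induction rule: left_normed.induct)
    case (step i u x h a)
    then show ?case
      unfolding commutator_def using N_gen by (intro N_mult N_inv)
  qed (rule N_gen)
  have "x \<in> N"
    using assms(1)
  proof (induction rule: level_induct)
    case one
    then show ?case using level_closed by (simp add: N_def)
  qed (auto intro: N_left_normed N_mult N_inv)
  then show ?thesis using assms(2) by (simp add: N_def)
qed

lemma gen_in_level_0: "h \<in> X a \<Longrightarrow> h \<in> level 0"
  using gen_in_level level_antimono by blast

lemma level_subset_level_0: "x \<in> level w \<Longrightarrow> x \<in> level 0"
  using level_antimono by blast

text \<open>Left-normed commutators satisfy this by construction. Products and inverses follow from
  [xy,h] = x[y,h]x^-1 [x,h] and [x^-1,h] = x^-1 [x,h]^-1 x, since the levels are stable under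
  conjugation.\<close>

lemma commutator_gen_in_level:
  assumes "x \<in> level w" and h: "h \<in> X a"
  shows "commutator x h \<in> level (w + a)"
proof -
  have hc: "h \<in> carrier G" using gen_closed h by blast
  show ?thesis
    using assms(1)
  proof (induction rule: level_induct)
    case one
    then show ?case using hc level_one by (simp add: commutator_def)
  next
    case (left_normed x i u)
    then show ?case using left_normed.step[OF left_normed(1) h] left_normed_in_level by auto
  next
    case (inv x)
    have xc: "x \<in> carrier G" using inv level_closed by blast
    have "inv x \<otimes> inv (commutator x h) \<otimes> inv (inv x) \<in> level (w + a)"
      using inv by (intro level_conj level_inv) (auto intro: level_subset_level_0)
    moreover have "inv x \<otimes> inv (commutator x h) \<otimes> inv (inv x) = commutator (inv x) h"
      using xc hc by (simp add: commutator_def word_simps)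
    ultimately show ?case by simp
  next
    case (mult x y)
    have c: "x \<in> carrier G" "y \<in> carrier G" using mult level_closed by blast+
    have "(x \<otimes> commutator y h \<otimes> inv x) \<otimes> commutator x h \<in> level (w + a)"
      using mult by (intro level_conj level_mult) (auto intro: level_subset_level_0)
    moreover have "(x \<otimes> commutator y h \<otimes> inv x) \<otimes> commutator x h = commutator (x \<otimes> y) h"
      using c hc by (simp add: commutator_def word_simps)
    ultimately show ?case by simp
  qed
qed

lemma hom_level:
  assumes t: "t \<in> hom G G" and X: "\<And>a h. h \<in> X a \<Longrightarrow> t h \<in> X a"
    and "x \<in> level w"
  shows "t x \<in> level w"
proof -
  interpret group_hom G G t by unfold_locales (rule t)
  have "left_normed i u (t x)" if "left_normed i u x" for i u x
    using that
  proof (induction rule: left_normed.induct)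
    case (step i u x h a)
    have "t (commutator x h) = commutator (t x) (t h)"
      using left_normed_closed[OF step(1)] gen_closed[OF step(2)] by (simp add: commutator_def)
    then show ?case using step X left_normed.step by simp
  qed (use X left_normed.base in simp)
  then have ln: "t x \<in> level w" if "left_normed i u x" "w \<le> u" for i u x
    using that left_normed_in_level by blast
  show ?thesis
    using assms(3)
    by (induction rule: level_induct)
      (use ln level_one level_mult level_inv level_closed in auto)
qed

text \<open>A homomorphism that moves every generator by a generator of one more weight acts
  trivially on each level modulo the next. For shifts of sequences the displacement of a generator
  is a differenced exponent.\<close>

lemma hom_displacement_level:
  assumes t: "t \<in> hom G G" and X: "\<And>a h. h \<in> X a \<Longrightarrow> t h \<in> X a"
    and disp: "\<And>a h. h \<in> X a \<Longrightarrow> t h \<otimes> inv h \<in> X (Suc a)"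
    and "x \<in> level w"
  shows "t x \<otimes> inv x \<in> level (Suc w)"
proof -
  interpret group_hom G G t by unfold_locales (rule t)
  have ln: "t x \<otimes> inv x \<in> level (Suc u)" if "left_normed i u x" for i u x
    using that
  proof (induction rule: left_normed.induct)
    case (base h a)
    then show ?case using disp gen_in_level by blast
  next
    case (step i u x y a)
    have xc: "x \<in> carrier G" and yc: "y \<in> carrier G"
      using step left_normed_closed gen_closed by blast+
    have x0: "x \<in> level 0" and y0: "y \<in> level 0"
      using step left_normed_in_level gen_in_level_0 by blast+
    \<comment> \<open>The displacement of \<open>x\<close> is put on its right and that of
      \<open>y\<close> on its left. Then \<open>d\<close> only has to be commuted with the generator
      \<open>t y\<close>, and \<open>e\<close> is itself a generator, so that
      \<open>commutator_gen_in_level\<close> applies throughout.\<close>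
    define d where "d = inv x \<otimes> (t x \<otimes> inv x) \<otimes> inv (inv x)"
    define e where "e = t y \<otimes> inv y"
    have d: "d \<in> level (Suc u)"
      unfolding d_def using step.IH x0 by (intro level_conj level_inv)
    then have dc: "d \<in> carrier G" using level_closed by blast
    have tx: "t x = x \<otimes> d"
      using xc by (simp add: d_def word_simps)
    have e: "e \<in> X (Suc a)"
      unfolding e_def using disp step(2) by blast
    then have ec: "e \<in> carrier G" and e0: "e \<in> level 0" using gen_closed gen_in_level_0 by blast+
    have ty: "t y = e \<otimes> y"
      using yc by (simp add: e_def word_simps)
    define c where "c = commutator x y"
    have c: "c \<in> level (u + a)"
      unfolding c_def using step left_normed.step left_normed_in_level by blast
    have cc: "c \<in> carrier G" using c level_closed by blast
    have 1: "x \<otimes> commutator d (t y) \<otimes> inv x \<in> level (Suc (u + a))"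
      using commutator_gen_in_level[OF d X[OF step(2)]] x0 by (intro level_conj) auto
    have 2: "commutator x e \<in> level (Suc (u + a))"
      using commutator_gen_in_level[OF left_normed_in_level[OF step(1)] e] by auto
    have "commutator c e \<in> level ((u + a) + Suc a)"
      by (rule commutator_gen_in_level[OF c e])
    then have 3: "inv (commutator c e) \<in> level (Suc (u + a))"
      using level_antimono[of "Suc (u + a)" "(u + a) + Suc a"] level_inv by auto
    \<comment> \<open>Expansion of [xd, ey][x,y]^-1 by the product rules for commutators: every
      factor contains \<open>d\<close> or \<open>e\<close>, and with it the extra unit of
      weight.\<close>
    have "t (commutator x y) \<otimes> inv (commutator x y)
        = (x \<otimes> commutator d (t y) \<otimes> inv x) \<otimes> commutator x e \<otimes> inv (commutator c e)"
      using xc yc ec dc unfolding c_def commutator_def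
      by (simp add: tx ty word_simps)
    then show ?case using 1 2 3 level_mult by metis
  qed
  show ?thesis
    using assms(4)
  proof (induction rule: level_induct)
    case (left_normed x i u)
    then show ?case using ln level_antimono[of "Suc w" "Suc u"] by blast
  next
    case (inv x)
    have "inv x \<otimes> inv (t x \<otimes> inv x) \<otimes> inv (inv x) \<in> level (Suc w)"
      using inv by (intro level_conj level_inv) (auto intro: level_subset_level_0)
    moreover have "inv x \<otimes> inv (t x \<otimes> inv x) \<otimes> inv (inv x) = t (inv x) \<otimes> inv (inv x)"
      using level_closed[OF inv(1)] by (simp add: word_simps)
    ultimately show ?case by simp
  next
    case (mult x y)
    have "(t x \<otimes> inv x) \<otimes> (x \<otimes> (t y \<otimes> inv y) \<otimes> inv x) \<in> level (Suc w)"
      using level_mult[OF mult(3) level_conj[OF level_subset_level_0[OF mult(1)] mult(4)]] .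
    moreover have "(t x \<otimes> inv x) \<otimes> (x \<otimes> (t y \<otimes> inv y) \<otimes> inv x) = t (x \<otimes> y) \<otimes> inv (x \<otimes> y)"
      using level_closed[OF mult(1)] level_closed[OF mult(2)] by (simp add: word_simps)
    ultimately show ?case by simp
  qed (simp add: level_one)
qed

end

subsection \<open>Polynomial sequences in a nilpotent group\<close>

text \<open>The number \<open>s\<close> bounds the nilpotency step, and \<open>D\<close> is meant to
  exceed the degrees of all exponents that occur.\<close>

locale polynomial_sequences = group G for G (structure) +
  fixes D s :: nat
  assumes nilpotent: "lower_central_series G s = {\<one>}"
begin

abbreviation "SG \<equiv> seq_group G"

text \<open>Truncated subtraction: for \<open>a \<ge> D\<close> only the trivial sequence remains.\<close>

definition power_seqs :: "nat \<Rightarrow> (int \<Rightarrow> 'a) set" where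
  "power_seqs a = {\<lambda>n. S [^] q n | S q. S \<in> carrier G \<and> q \<in> int_polys_below (D - a)}"

lemma power_seqsI:
  "S \<in> carrier G \<Longrightarrow> q \<in> int_polys_below (D - a) \<Longrightarrow> (\<lambda>n. S [^] q n) \<in> power_seqs a"
  by (auto simp: power_seqs_def)

lemma power_seqsE:
  assumes "h \<in> power_seqs a"
  obtains S q where "S \<in> carrier G" "q \<in> int_polys_below (D - a)" "h = (\<lambda>n. S [^] q n)"
  using assms by (auto simp: power_seqs_def)

sublocale S: group "seq_group G"
  by (rule group_seq_group)

sublocale S: weighted_generators "seq_group G" power_seqs
proof
  show closed: "h \<in> carrier SG" if "h \<in> power_seqs a" for h a
    using that by (auto simp: power_seqs_def carrier_seq_group)
  show "inv\<^bsub>SG\<^esub> h \<in> power_seqs a" if h: "h \<in> power_seqs a" for h a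
  proof -
    obtain S q where S: "S \<in> carrier G" and q: "q \<in> int_polys_below (D - a)"
      and hq: "h = (\<lambda>n. S [^] q n)"
      using h by (rule power_seqsE)
    have "inv\<^bsub>SG\<^esub> h = (\<lambda>n. S [^] (- q n))"
      using inv_seq_group[OF closed[OF h]] S by (simp add: hq int_pow_neg)
    then show ?thesis
      using power_seqsI[OF S uminus_in_int_polys_below[OF q]] by simp
  qed
qed

lemma seq_commutator:
  assumes "x \<in> carrier SG" "y \<in> carrier SG"
  shows "S.commutator x y n = commutator (x n) (y n)"
  using assms
  by (simp add: S.commutator_def commutator_def mult_seq_group inv_seq_group)

lemma left_normed_lower_central_series:
  "S.left_normed i u x \<Longrightarrow> x n \<in> lower_central_series G i"
proof (induction rule: S.left_normed.induct)
  case (base h a)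
  then show ?case using S.gen_closed carrier_seq_group by auto
next
  case (step i u x h a)
  then show ?case
    using commutator_in_lower_central_series[OF step.IH, of "h n"] S.gen_closed[OF step(2)]
      S.left_normed_closed[OF step(1)]
    by (simp add: seq_commutator carrier_seq_group del: lower_central_series.simps)
qed

text \<open>A generator heavier than \<open>D\<close> is the trivial sequence and makes every
  commutator containing it trivial. Otherwise each of the \<open>i + 1\<close> entries weighs at
  most \<open>D\<close>.\<close>

lemma left_normed_weight:
  "S.left_normed i u x \<Longrightarrow> u \<le> Suc i * D \<or> x = (\<lambda>_. \<one>)"
proof (induction rule: S.left_normed.induct)
  case (base h a)
  then show ?case
    by (cases "a \<le> D") (auto simp: power_seqs_def)
next
  case (step i u x h a)
  have c: "x n \<in> carrier G" "h n \<in> carrier G" for n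
    using step(1,2) S.left_normed_closed S.gen_closed by (auto simp: carrier_seq_group)
  have "h = (\<lambda>_. \<one>)" if "\<not> a \<le> D"
    using step(2) that by (auto simp: power_seqs_def)
  moreover have "S.commutator x h = (\<lambda>_. \<one>)" if "x = (\<lambda>_. \<one>) \<or> h = (\<lambda>_. \<one>)"
  proof
    fix n
    have "x n = \<one> \<or> h n = \<one>" using that by auto
    then show "S.commutator x h n = \<one>"
      using step(1,2) S.left_normed_closed S.gen_closed c[of n]
      by (auto simp: seq_commutator commutator_def)
  qed
  ultimately show ?case
    using step.IH by (cases "a \<le> D") auto
qed

text \<open>A commutator of weight above \<open>s * D\<close> with at least \<open>s\<close>
  brackets takes values in a trivial term of the lower central series; one with fewer brackets
  exceeds the bound of \<open>left_normed_weight\<close> and is trivial for that reason.\<close>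

lemma level_eventually_trivial: "S.level (Suc (s * D)) = {\<lambda>_. \<one>}"
proof -
  have ln: "x = (\<lambda>_. \<one>)" if "S.left_normed i u x" "s * D < u" for i u x
  proof (cases "s \<le> i")
    case True
    then show ?thesis
      using left_normed_lower_central_series[OF that(1)]
        lower_central_series_trivial_mono[OF nilpotent True] by auto
  next
    case False
    then have "Suc i * D \<le> s * D" by (intro mult_le_mono) auto
    then show ?thesis using left_normed_weight[OF that(1)] that(2) by simp
  qed
  have "x = (\<lambda>_. \<one>)" if "x \<in> S.level (Suc (s * D))" for x
    using that
    by (induction rule: S.level_induct)
      (auto simp: inv_seq_group mult_seq_group one_seq_group carrier_seq_group intro: ln)
  then show ?thesis
    using S.level_one one_seq_group by auto
qed

lemma shift_hom: "(\<lambda>f n. f (n + k)) \<in> hom SG SG"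
  by (auto simp: hom_def carrier_seq_group mult_seq_group)

lemma eval_hom: "(\<lambda>f n. f k) \<in> hom SG SG"
  by (auto simp: hom_def carrier_seq_group mult_seq_group)

lemma shift_power_seqs: "h \<in> power_seqs a \<Longrightarrow> (\<lambda>n. h (n + k)) \<in> power_seqs a"
  using power_seqsI shift_in_int_polys_below by (elim power_seqsE) simp

lemma eval_power_seqs: "h \<in> power_seqs a \<Longrightarrow> (\<lambda>n. h k) \<in> power_seqs a"
  using power_seqsI eval_in_int_polys_below by (elim power_seqsE) simp

lemma difference_power_seqs:
  assumes "h \<in> power_seqs a"
  shows "(\<lambda>n. h (n + k)) \<otimes>\<^bsub>SG\<^esub> inv\<^bsub>SG\<^esub> h \<in> power_seqs (Suc a)"
proof -
  obtain S q where h: "h = (\<lambda>n. S [^] q n)" and S: "S \<in> carrier G" and q: "q \<in> int_polys_below (D - a)"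
    using assms by (elim power_seqsE)
  have "(\<lambda>n. h (n + k)) \<otimes>\<^bsub>SG\<^esub> inv\<^bsub>SG\<^esub> h = (\<lambda>n. S [^] (q (n + k) - q n))"
    using S.gen_closed[OF assms] S by (simp add: mult_seq_group inv_seq_group h int_pow_diff)
  moreover have "(\<lambda>n. q (n + k) - q n) \<in> int_polys_below (D - Suc a)"
    using difference_in_int_polys_below[OF q, of k] by simp
  ultimately show ?thesis using power_seqsI[OF S] by simp
qed

lemma shift_level: "f \<in> S.level w \<Longrightarrow> (\<lambda>n. f (n + k)) \<in> S.level w"
  by (rule S.hom_level[OF shift_hom]) (rule shift_power_seqs)

lemma eval_level: "f \<in> S.level w \<Longrightarrow> (\<lambda>n. f k) \<in> S.level w"
  by (rule S.hom_level[OF eval_hom]) (rule eval_power_seqs)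

lemma difference_level:
  assumes "f \<in> S.level w"
  shows "(\<lambda>n. f (n + k) \<otimes> inv (f n)) \<in> S.level (Suc w)"
  using S.hom_displacement_level[OF shift_hom shift_power_seqs difference_power_seqs assms]
  by (simp add: mult_seq_group inv_seq_group S.level_closed[OF assms])

text \<open>Constants belong to the levels of the generated group, so that evaluation preserves the
  levels; the normalisation \<open>f 0 = \<one>\<close> removes them again.\<close>

definition plevel :: "nat \<Rightarrow> (int \<Rightarrow> 'a) set" where
  "plevel w = {f \<in> S.level w. f 0 = \<one>}"

text \<open>The shift, renormalised to take the value one at 0, so that \<open>f (n + k)\<close> is
  \<open>f k\<close> times \<open>sigma k f n\<close>. It is in general no homomorphism; what
  survives is that it moves each \<open>plevel\<close> only by elements of the next.\<close>

definition sigma :: "int \<Rightarrow> (int \<Rightarrow> 'a) \<Rightarrow> int \<Rightarrow> 'a" where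
  "sigma k f = (\<lambda>n. inv (f k) \<otimes> f (n + k))"

lemma plevel_closed: "f \<in> plevel w \<Longrightarrow> f n \<in> carrier G"
  using S.level_closed by (auto simp: plevel_def carrier_seq_group)

lemma subgroup_plevel: "subgroup (plevel w) SG"
proof
  show "plevel w \<subseteq> carrier SG"
    using S.level_closed by (auto simp: plevel_def)
qed (auto simp: plevel_def mult_seq_group one_seq_group inv_seq_group S.level_closed
    intro: S.level_mult[unfolded mult_seq_group] S.level_one[unfolded one_seq_group]
      S.level_inv[of _ w])

lemma plevel_antimono: "v \<le> w \<Longrightarrow> plevel w \<subseteq> plevel v"
  using S.level_antimono by (auto simp: plevel_def)

lemma plevel_conj:
  assumes "x \<in> plevel 0" "y \<in> plevel w"
  shows "x \<otimes>\<^bsub>SG\<^esub> y \<otimes>\<^bsub>SG\<^esub> inv\<^bsub>SG\<^esub> x \<in> plevel w"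
  using assms S.level_conj[of x y w]
  by (auto simp: plevel_def mult_seq_group inv_seq_group S.level_closed)

lemma plevel_eventually_trivial: "plevel (Suc (s * D)) = {\<one>\<^bsub>SG\<^esub>}"
  by (auto simp: plevel_def level_eventually_trivial one_seq_group)

text \<open>The displacement is the difference sequence multiplied on the left by the constant
  inverse of \<open>f k\<close>. As \<open>f 0\<close> is one, \<open>f k\<close> is the value of
  the difference sequence at 0, so this constant also lies one level deeper.\<close>

lemma sigma_displacement:
  assumes f: "f \<in> plevel w"
  shows "sigma k f \<otimes>\<^bsub>SG\<^esub> inv\<^bsub>SG\<^esub> f \<in> plevel (Suc w)"
proof -
  have fl: "f \<in> S.level w" and f0: "f 0 = \<one>" using f by (auto simp: plevel_def)
  note fc = plevel_closed[OF f]
  let ?d = "\<lambda>n. f (n + k) \<otimes> inv (f n)"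
  have d: "?d \<in> S.level (Suc w)" by (rule difference_level[OF fl])
  have "(\<lambda>n. ?d 0) \<in> S.level (Suc w)" by (rule eval_level[OF d])
  then have "inv\<^bsub>SG\<^esub> (\<lambda>n. f k) \<in> S.level (Suc w)"
    using fc f0 S.level_inv by simp
  then have "inv\<^bsub>SG\<^esub> (\<lambda>n. f k) \<otimes>\<^bsub>SG\<^esub> ?d \<in> S.level (Suc w)"
    using d S.level_mult by blast
  moreover have "inv\<^bsub>SG\<^esub> (\<lambda>n. f k) \<otimes>\<^bsub>SG\<^esub> ?d = sigma k f \<otimes>\<^bsub>SG\<^esub> inv\<^bsub>SG\<^esub> f"
    using fc by (simp add: carrier_seq_group mult_seq_group inv_seq_group sigma_def m_assoc)
  moreover have "(sigma k f \<otimes>\<^bsub>SG\<^esub> inv\<^bsub>SG\<^esub> f) 0 = \<one>"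
    using fc f0 by (simp add: carrier_seq_group mult_seq_group inv_seq_group sigma_def)
  ultimately show ?thesis by (simp add: plevel_def)
qed

lemma sigma_plevel:
  assumes f: "f \<in> plevel w"
  shows "sigma k f \<in> plevel w"
proof -
  have "sigma k f \<otimes>\<^bsub>SG\<^esub> inv\<^bsub>SG\<^esub> f \<otimes>\<^bsub>SG\<^esub> f \<in> plevel w"
    by (rule subgroup.m_closed[OF subgroup_plevel _ f])
      (use sigma_displacement[OF f] plevel_antimono[of w "Suc w"] in auto)
  then show ?thesis
    using plevel_closed[OF f]
    by (simp add: carrier_seq_group mult_seq_group inv_seq_group sigma_def m_assoc)
qed

lemma sigma_add:
  assumes "\<And>n. f n \<in> carrier G"
  shows "sigma k (sigma l f) = sigma (k + l) f"
  using assms by (simp add: sigma_def word_simps fun_eq_iff add.assoc)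

lemma sigma_zero: "f \<in> plevel w \<Longrightarrow> sigma 0 f = f"
  using plevel_closed[of f w] by (auto simp: sigma_def plevel_def)

lemma sigma_inj:
  assumes "f \<in> plevel 0" "h \<in> plevel 0" "sigma k f = sigma k h"
  shows "f = h"
proof -
  have "sigma (- k) (sigma k f) = sigma (- k) (sigma k h)" using assms(3) by simp
  then show ?thesis
    using assms(1,2) plevel_closed by (simp add: sigma_add sigma_zero)
qed

text \<open>These sequences are fixed by every \<open>sigma k\<close>, which makes them the
  exceptional case of the induction.\<close>

lemma sigma_power: "r \<in> carrier G \<Longrightarrow> sigma k (\<lambda>n. r [^] n) = (\<lambda>n. r [^] n)"
  by (simp add: sigma_def fun_eq_iff int_pow_mult add.commute[of _ k] inv_cancel_left)

definition power_seq :: "(int \<Rightarrow> 'a) \<Rightarrow> bool" where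
  "power_seq f \<longleftrightarrow> (\<exists>r\<in>carrier G. f = (\<lambda>n. r [^] n))"

lemma polynomial_product_plevel:
  assumes T: "\<And>j. j \<in> {1..d} \<Longrightarrow> T j \<in> carrier G"
    and q: "\<And>j. j \<in> {1..d} \<Longrightarrow> q j \<in> integral_polys_0"
    and deg: "\<And>j. j \<in> {1..d} \<Longrightarrow> degree (q j) < D"
  shows "polynomial_product G d T q \<in> plevel 0"
proof -
  define h where "h j = (\<lambda>n::int. T j [^] \<lfloor>poly (q j) (of_int n)\<rfloor>)" for j
  have h: "h j \<in> plevel 0" if j: "j \<in> {1..d}" for j
  proof -
    have "poly (q j) (of_int n) \<in> \<int>" for n :: int
      using q[OF j] by (auto simp: integral_polys_0_def)
    then have "of_int \<lfloor>poly (q j) (of_int n)\<rfloor> = poly (q j) (of_int n)" for n :: int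
      by simp
    \<comment> \<open>Since \<open>D\<close> exceeds a degree it is positive, and
      \<open>Suc (D - 1)\<close> is \<open>D\<close>.\<close>
    then have "(\<lambda>n. \<lfloor>poly (q j) (of_int n)\<rfloor>) \<in> int_polys_below (Suc (D - 1))"
      using deg[OF j] by (intro poly_in_int_polys_below[of _ "q j"]) auto
    then have "h j \<in> power_seqs 0"
      unfolding h_def using T[OF j] deg[OF j] by (intro power_seqsI) auto
    moreover have "h j 0 = \<one>"
      using q[OF j] by (simp add: h_def integral_polys_0_def)
    ultimately show ?thesis
      using S.gen_in_level by (auto simp: plevel_def)
  qed
  have "(\<lambda>n. foldr (\<otimes>) (map (\<lambda>j. h j n) js) \<one>) \<in> plevel 0" if "set js \<subseteq> {1..d}" for js
    using that
  proof (induction js)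
    case Nil
    then show ?case
      using subgroup.one_closed[OF subgroup_plevel] by (simp add: one_seq_group)
  next
    case (Cons j js)
    then show ?case
      using subgroup.m_closed[OF subgroup_plevel, of "h j" 0] h[of j] by (simp add: mult_seq_group)
  qed
  from this[of "[1..<Suc d]"] show ?thesis
    by (simp add: h_def polynomial_product_def [abs_def] atLeastLessThanSuc_atLeastAtMost del: upt_Suc)
qed

end

section \<open>Collisions between shifted sequences\<close>

locale torsion_free_polynomial_sequences = polynomial_sequences +
  assumes torsion_free: "x \<in> carrier G \<Longrightarrow> x [^] (m::int) = \<one> \<Longrightarrow> m \<noteq> 0 \<Longrightarrow> x = \<one>"
begin

text \<open>Induction from the deepest level upwards. The difference sequence is periodic and one
  level deeper, hence a constant \<open>c\<close>; so \<open>f n\<close> is \<open>c [^] n\<close>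
  times \<open>f 0\<close>, periodicity gives \<open>c [^] m = \<one>\<close>, and torsion-freeness
  gives \<open>c = \<one>\<close>.\<close>

lemma periodic_imp_constant:
  assumes "f \<in> S.level w" and "\<And>n. f (n + m) = f n" and "m \<noteq> 0"
  shows "f n = f 0"
  using assms
proof (induction "Suc (s * D) - w" arbitrary: w f n)
  case 0
  then have "f \<in> S.level (Suc (s * D))"
    using S.level_antimono[of "Suc (s * D)" w] by auto
  then show ?case using level_eventually_trivial by auto
next
  case (Suc i)
  have fc: "f n \<in> carrier G" for n
    using Suc.prems(1) S.level_closed carrier_seq_group by blast
  define c where "c = f 1 \<otimes> inv (f 0)"
  have cc: "c \<in> carrier G" using fc by (simp add: c_def)
  let ?d = "\<lambda>n. f (n + 1) \<otimes> inv (f n)"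
  have per: "f (n + m + 1) = f (n + 1)" for n
    using Suc.prems(2)[of "n + 1"] by (simp add: ac_simps)
  have "?d n = ?d 0" for n
    by (rule Suc.hyps(1)[OF _ difference_level[OF Suc.prems(1)]])
      (use Suc.hyps(2) Suc.prems(2,3) per in auto)
  then have "f (n + 1) \<otimes> inv (f n) = c" for n
    by (simp add: c_def)
  then have step: "f (n + 1) = c \<otimes> f n" for n
    by (metis fc inv_closed inv_solve_right' m_closed inv_inv)
  have pow: "f n = c [^] n \<otimes> f 0" for n
    by (rule int_power_recursion[of f c]) (use fc cc step in auto)
  have "c [^] m \<otimes> f 0 = \<one> \<otimes> f 0"
    using pow[of m] Suc.prems(2)[of 0] fc by simp
  then have "c [^] m = \<one>"
    using fc cc by (simp only: right_cancel int_pow_closed one_closed)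
  then have "c = \<one>"
    using torsion_free cc Suc.prems(3) by blast
  then show ?case using pow[of n] fc by simp
qed

text \<open>A collision says that translation by \<open>k - l\<close> multiplies \<open>f\<close> on
  the left by a constant. This constant cancels in the quotients of consecutive values, which are
  therefore periodic, hence constant.\<close>

lemma sigma_collision_imp_power:
  assumes f: "f \<in> plevel 0" and eq: "sigma k f = sigma l f" and "k \<noteq> l"
  obtains r where "r \<in> carrier G" "f = (\<lambda>n. r [^] n)"
proof -
  note fc = plevel_closed[OF f]
  have fl: "f \<in> S.level 0" and f0: "f 0 = \<one>" using f by (auto simp: plevel_def)
  define c where "c = f k \<otimes> inv (f l)"
  have cc: "c \<in> carrier G" using fc by (simp add: c_def)
  have per: "f (n + (k - l)) = c \<otimes> f n" for n
  proof -
    have "inv (f k) \<otimes> f (n - l + k) = inv (f l) \<otimes> f (n - l + l)"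
      using eq by (simp add: sigma_def fun_eq_iff)
    then have "f k \<otimes> (inv (f k) \<otimes> f (n - l + k)) = f k \<otimes> (inv (f l) \<otimes> f n)"
      by simp
    then show ?thesis using fc by (simp add: c_def word_simps algebra_simps)
  qed
  let ?r = "\<lambda>n. inv (f n) \<otimes> f (n + 1)"
  have "inv\<^bsub>SG\<^esub> f \<otimes>\<^bsub>SG\<^esub> (\<lambda>n. f (n + 1)) \<in> S.level 0"
    by (intro S.level_mult S.level_inv shift_level fl)
  then have rl: "?r \<in> S.level 0"
    using fc by (simp add: mult_seq_group inv_seq_group carrier_seq_group)
  have "?r (n + (k - l)) = ?r n" for n
  proof -
    have "f (n + (k - l) + 1) = c \<otimes> f (n + 1)"
      using per[of "n + 1"] by (simp add: algebra_simps)
    then show ?thesis using per[of n] fc cc by (simp add: word_simps)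
  qed
  then have r: "?r n = f 1" for n
    using periodic_imp_constant[OF rl, of "k - l" n] \<open>k \<noteq> l\<close> f0 fc by auto
  \<comment> \<open>The constant quotient stands on the right of \<open>f n\<close>; passing to
    inverses brings it to the left, as \<open>int_power_recursion\<close> expects.\<close>
  have "inv (f (n + 1)) = inv (f 1) \<otimes> inv (f n)" for n
  proof -
    have "f (n + 1) = f n \<otimes> f 1"
      using r[of n] fc by (metis inv_cancel_left(1))
    then show ?thesis using fc by (simp add: inv_mult_group)
  qed
  then have "inv (f n) = inv (f 1) [^] n \<otimes> inv (f 0)" for n
    using int_power_recursion[of "\<lambda>n. inv (f n)" "inv (f 1)" n] fc by auto
  then have "inv (f n) = inv (f 1 [^] n)" for n
    using fc f0 by (simp add: int_pow_inv)
  then have "f n = f 1 [^] n" for n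
    using fc by (metis inv_inv int_pow_closed)
  then show thesis using that fc by blast
qed

lemma sigma_collision: "f \<in> plevel 0 \<Longrightarrow> sigma k f = sigma l f \<Longrightarrow> k \<noteq> l \<Longrightarrow> power_seq f"
  using sigma_collision_imp_power unfolding power_seq_def by metis

text \<open>Already two such \<open>k\<close> are impossible: they would make \<open>f\<close> a
  power sequence, fixed by all shifts, and then \<open>sigma l f = sigma l h\<close> would force
  \<open>f = h\<close>.\<close>

lemma finite_sigma_collisions:
  assumes f: "f \<in> plevel 0" and h: "h \<in> plevel 0" and ne: "f \<noteq> h"
  shows "finite {k. sigma k f = sigma l h}"
proof (rule ccontr)
  assume inf: "infinite {k. sigma k f = sigma l h}"
  then obtain k where k: "sigma k f = sigma l h"
    using not_finite_existsD by blast
  have "infinite ({k. sigma k f = sigma l h} - {k})" using inf by simp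
  then have "{k. sigma k f = sigma l h} - {k} \<noteq> {}" by (rule infinite_imp_nonempty)
  then obtain k' where k': "sigma k' f = sigma l h" "k' \<noteq> k" by auto
  then have "power_seq f" using sigma_collision[OF f] k by metis
  then have "sigma l f = f" "sigma k f = f" using sigma_power by (auto simp: power_seq_def)
  then have "sigma l f = sigma l h" using k by simp
  then show False using sigma_inj[OF f h] ne by blast
qed

end

subsection \<open>The PET ordering\<close>

context group
begin

text \<open>The weight vector of PET induction. The outermost layer comes first and so counts most
  in the lexicographic order.\<close>

definition pet_vector :: "(nat \<Rightarrow> 'a set) \<Rightarrow> nat \<Rightarrow> 'a set \<Rightarrow> nat list" where
  "pet_vector M R A =
     map (\<lambda>w. card ((\<lambda>x. M (Suc w) #> x) ` (A \<inter> (M w - M (Suc w))))) [0..<R]"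

text \<open>With \<open>a\<close> in the deepest layer that \<open>A\<close> meets, dividing by
  \<open>a\<close> preserves the cosets in all outer layers, while in the layer of \<open>a\<close>
  it translates the cosets and sends that of \<open>a\<close> itself into the next term. Deeper
  entries may grow. The size of \<open>\<Sigma>\<close> is irrelevant to the cosets, since each
  \<open>\<sigma>\<close> keeps \<open>x\<close> in its coset.\<close>

lemma pet_vector_decreases:
  assumes sub: "\<And>w. subgroup (M w) G"
    and anti: "\<And>w. M (Suc w) \<subseteq> M w"
    and conj: "\<And>x y w. x \<in> M 0 \<Longrightarrow> y \<in> M w \<Longrightarrow> x \<otimes> y \<otimes> inv x \<in> M w"
    and trivial: "M R = {\<one>}"
    and A: "finite A" "A \<noteq> {}" "A \<subseteq> M 0 - {\<one>}"
  obtains a where "a \<in> A"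
    and "\<And>\<Sigma>. \<lbrakk>\<Sigma> \<noteq> {}; \<And>\<sigma> x w. \<sigma> \<in> \<Sigma> \<Longrightarrow> x \<in> M w \<Longrightarrow> \<sigma> x \<otimes> inv x \<in> M (Suc w);
            \<And>\<sigma> x. \<sigma> \<in> \<Sigma> \<Longrightarrow> x \<in> M 0 \<Longrightarrow> \<sigma> x \<in> carrier G\<rbrakk> \<Longrightarrow>
          (pet_vector M R ({\<sigma> x \<otimes> inv a | \<sigma> x. \<sigma> \<in> \<Sigma> \<and> x \<in> A} - {\<one>}), pet_vector M R A)
            \<in> lexn less_than R"
proof -
  have anti': "M w \<subseteq> M v" if "v \<le> w" for v w
    using that by (induction rule: dec_induct) (use anti in blast)+
  have closed: "x \<in> carrier G" if "x \<in> M w" for x w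
    using subgroup.mem_carrier[OF sub that] .
  \<comment> \<open>For nontrivial \<open>x\<close> in \<open>M 0\<close> this is the index of the
    last term containing \<open>x\<close>.\<close>
  define lev where "lev x = (LEAST w. x \<notin> M (Suc w))" for x
  have lev: "x \<in> M w \<longleftrightarrow> w \<le> lev x" and lev_less: "lev x < R" if x: "x \<in> M 0 - {\<one>}" for x w
  proof -
    have "x \<notin> M R" using x trivial by auto
    then have "R \<noteq> 0" using x by (metis DiffD1)
    then obtain R' where R': "R = Suc R'" using not0_implies_Suc by blast
    have 1: "x \<notin> M (Suc (lev x))"
      unfolding lev_def by (rule LeastI[of _ R']) (use \<open>x \<notin> M R\<close> R' in simp)
    have "lev x \<le> R'"
      unfolding lev_def by (rule Least_le) (use \<open>x \<notin> M R\<close> R' in simp)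
    then show "lev x < R" using R' by simp
    have 2: "x \<in> M (lev x)"
    proof (cases "lev x")
      case (Suc v)
      then have "v < (LEAST w. x \<notin> M (Suc w))" by (simp add: lev_def)
      then have "x \<in> M (Suc v)" using not_less_Least by blast
      then show ?thesis using Suc by simp
    qed (use x in simp)
    show "x \<in> M w \<longleftrightarrow> w \<le> lev x"
      using anti'[of w "lev x"] anti'[of "Suc (lev x)" w] 1 2 not_less_eq_eq by blast
  qed
  obtain a where a: "a \<in> A" and a_max: "\<And>x. x \<in> A \<Longrightarrow> lev x \<le> lev a"
  proof -
    have "Max (lev ` A) \<in> lev ` A" using A by simp
    then obtain a where "a \<in> A" "lev a = Max (lev ` A)" by auto
    moreover have "lev x \<le> Max (lev ` A)" if "x \<in> A" for x using A that by simp
    ultimately show thesis using that by simp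
  qed
  define w0 where "w0 = lev a"
  have w0: "w0 < R" unfolding w0_def using lev_less a A(3) by blast
  have aM: "a \<in> M w0" and inv_aM: "inv a \<in> M w0"
    using lev[of a w0] a A(3) subgroup.m_inv_closed[OF sub] unfolding w0_def by blast+
  have ac: "a \<in> carrier G" using closed aM by blast
  show thesis
  proof (rule that[OF a])
    fix \<Sigma> :: "('a \<Rightarrow> 'a) set"
    assume ne: "\<Sigma> \<noteq> {}"
      and disp: "\<And>\<sigma> x w. \<sigma> \<in> \<Sigma> \<Longrightarrow> x \<in> M w \<Longrightarrow> \<sigma> x \<otimes> inv x \<in> M (Suc w)"
      and \<sigma>c: "\<And>\<sigma> x. \<sigma> \<in> \<Sigma> \<Longrightarrow> x \<in> M 0 \<Longrightarrow> \<sigma> x \<in> carrier G"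
    define A' where "A' = {\<sigma> x \<otimes> inv a | \<sigma> x. \<sigma> \<in> \<Sigma> \<and> x \<in> A} - {\<one>}"
    define cos where "cos w B = (\<lambda>x. M (Suc w) #> x) ` (B \<inter> (M w - M (Suc w)))" for w B
    have xA: "x \<in> M 0 - {\<one>}" "x \<in> carrier G" if "x \<in> A" for x
      using that A(3) closed by auto
    \<comment> \<open>Outside the layer of \<open>a\<close>, both the displacement of
      \<open>x\<close> and the factor \<open>inv a\<close> lie in the next term, so the coset of
      \<open>x\<close> is unchanged.\<close>
    have low: "M (Suc (lev x)) #> (\<sigma> x \<otimes> inv a) = M (Suc (lev x)) #> x"
        "\<sigma> x \<otimes> inv a \<in> M (lev x) - M (Suc (lev x))"
      if \<sigma>: "\<sigma> \<in> \<Sigma>" and x: "x \<in> A" and v: "lev x < w0" for \<sigma> x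
    proof -
      have xc: "x \<in> carrier G" "\<sigma> x \<in> carrier G"
        using xA[OF x] \<sigma>c[OF \<sigma>] by auto
      have "inv a \<in> M (Suc (lev x))"
        using inv_aM anti'[of "Suc (lev x)" w0] v by auto
      then have "(\<sigma> x \<otimes> inv x) \<otimes> (x \<otimes> inv a \<otimes> inv x) \<in> M (Suc (lev x))"
        using disp[OF \<sigma>, of x "lev x"] lev[OF xA(1)[OF x]] conj[of x] xA(1)[OF x]
        by (intro subgroup.m_closed[OF sub, of "\<sigma> x \<otimes> inv x"]) auto
      then have in_coset: "\<sigma> x \<otimes> inv a \<otimes> inv x \<in> M (Suc (lev x))"
        using xc ac by (simp add: word_simps)
      then have mem: "\<sigma> x \<otimes> inv a \<in> M (Suc (lev x)) #> x"
        using xc ac by (intro subgroup.rcos_module_rev[OF sub is_group]) auto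
      show "M (Suc (lev x)) #> (\<sigma> x \<otimes> inv a) = M (Suc (lev x)) #> x"
        using repr_independence[OF mem xc(1) sub] by simp
      have "(\<sigma> x \<otimes> inv a \<otimes> inv x) \<otimes> x \<in> M (lev x)"
        using in_coset anti[of "lev x"] lev[OF xA(1)[OF x]]
        by (intro subgroup.m_closed[OF sub, of "\<sigma> x \<otimes> inv a \<otimes> inv x"]) auto
      then have 1: "\<sigma> x \<otimes> inv a \<in> M (lev x)"
        using xc ac by (simp add: word_simps)
      moreover have "\<sigma> x \<otimes> inv a \<notin> M (Suc (lev x))"
      proof
        assume *: "\<sigma> x \<otimes> inv a \<in> M (Suc (lev x))"
        have "inv (\<sigma> x \<otimes> inv a \<otimes> inv x) \<otimes> (\<sigma> x \<otimes> inv a) \<in> M (Suc (lev x))"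
          by (rule subgroup.m_closed[OF sub subgroup.m_inv_closed[OF sub in_coset] *])
        then have "x \<in> M (Suc (lev x))"
          using xc ac by (simp add: word_simps)
        then show False using lev[OF xA(1)[OF x]] by simp
      qed
      ultimately show "\<sigma> x \<otimes> inv a \<in> M (lev x) - M (Suc (lev x))" by simp
    qed
    \<comment> \<open>In the layer of \<open>a\<close> only the displacement is absorbed: cosets are
      translated by \<open>inv a\<close>, and the coset of \<open>a\<close> leaves the
      layer.\<close>
    have top: "M (Suc w0) #> (\<sigma> x \<otimes> inv a) = (M (Suc w0) #> x) #> inv a"
        "\<sigma> x \<otimes> inv a \<in> M w0"
        "M (Suc w0) #> x = M (Suc w0) #> a \<Longrightarrow> \<sigma> x \<otimes> inv a \<in> M (Suc w0)"
      if \<sigma>: "\<sigma> \<in> \<Sigma>" and x: "x \<in> A" and v: "lev x = w0" for \<sigma> x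
    proof -
      have xc: "x \<in> carrier G" "\<sigma> x \<in> carrier G"
        using xA[OF x] \<sigma>c[OF \<sigma>] by auto
      have xM: "x \<in> M w0" using lev[OF xA(1)[OF x]] v by simp
      have d: "\<sigma> x \<otimes> inv x \<in> M (Suc w0)" using disp[OF \<sigma> xM] .
      have "M (Suc w0) #> x #> inv a = M (Suc w0) #> (\<sigma> x \<otimes> inv x) #> (x \<otimes> inv a)"
        using coset_join2[OF _ sub d] closed[OF d] xc ac subgroup.subset[OF sub]
        by (simp add: coset_mult_assoc)
      also have "\<dots> = M (Suc w0) #> ((\<sigma> x \<otimes> inv x) \<otimes> (x \<otimes> inv a))"
        using xc ac subgroup.subset[OF sub] by (intro coset_mult_assoc) auto
      also have "(\<sigma> x \<otimes> inv x) \<otimes> (x \<otimes> inv a) = \<sigma> x \<otimes> inv a"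
        using xc ac by (simp add: word_simps)
      finally show "M (Suc w0) #> (\<sigma> x \<otimes> inv a) = (M (Suc w0) #> x) #> inv a" ..
      have "(\<sigma> x \<otimes> inv x) \<otimes> (x \<otimes> inv a) \<in> M w0"
        using d anti xM inv_aM
        by (intro subgroup.m_closed[OF sub, of "\<sigma> x \<otimes> inv x"] subgroup.m_closed[OF sub, of x]) auto
      then show "\<sigma> x \<otimes> inv a \<in> M w0" using xc ac by (simp add: word_simps)
      assume "M (Suc w0) #> x = M (Suc w0) #> a"
      then have "x \<in> M (Suc w0) #> a"
        using rcos_self[OF xc(1) sub[of "Suc w0"]] by simp
      then have "x \<otimes> inv a \<in> M (Suc w0)"
        using subgroup.rcos_module_imp[OF sub is_group ac] by blast
      then have "(\<sigma> x \<otimes> inv x) \<otimes> (x \<otimes> inv a) \<in> M (Suc w0)"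
        using d by (rule subgroup.m_closed[OF sub, rotated])
      then show "\<sigma> x \<otimes> inv a \<in> M (Suc w0)" using xc ac by (simp add: word_simps)
    qed
    have same: "cos w A' = cos w A" if w: "w < w0" for w
    proof
      show "cos w A' \<subseteq> cos w A"
      proof
        fix C assume "C \<in> cos w A'"
        then obtain \<sigma> x where \<sigma>: "\<sigma> \<in> \<Sigma>" "x \<in> A" and C: "C = M (Suc w) #> (\<sigma> x \<otimes> inv a)"
          and m: "\<sigma> x \<otimes> inv a \<in> M w - M (Suc w)"
          by (auto simp: cos_def A'_def)
        have "lev x < w0"
          using a_max[OF \<sigma>(2)] top(2)[OF \<sigma>] m anti'[of "Suc w" w0] w unfolding w0_def
          by (metis DiffD2 Suc_leI order_le_less subset_iff)
        note l = low[OF \<sigma> this]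
        have "lev x = w"
          using l(2) m anti'[of "Suc w" "lev x"] anti'[of "Suc (lev x)" w]
          by (metis DiffD1 DiffD2 not_less_eq_eq nle_le subset_iff)
        then show "C \<in> cos w A"
          using l(1) C \<sigma>(2) lev[OF xA(1)[OF \<sigma>(2)]] by (auto simp: cos_def)
      qed
      show "cos w A \<subseteq> cos w A'"
      proof
        fix C assume "C \<in> cos w A"
        then obtain x where x: "x \<in> A" and C: "C = M (Suc w) #> x" and m: "x \<in> M w - M (Suc w)"
          by (auto simp: cos_def)
        have "lev x = w"
          using m lev[OF xA(1)[OF x]] by (metis DiffD1 DiffD2 not_less_eq_eq nle_le)
        obtain \<sigma> where \<sigma>: "\<sigma> \<in> \<Sigma>" using ne by blast
        note l = low[OF \<sigma> x, unfolded \<open>lev x = w\<close>, OF w]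
        have "\<sigma> x \<otimes> inv a \<in> A'"
          unfolding A'_def using \<sigma> x l(2) subgroup.one_closed[OF sub, of "Suc w"] by auto
        then show "C \<in> cos w A'"
          unfolding cos_def C using l by (intro image_eqI[of _ _ "\<sigma> x \<otimes> inv a"]) auto
      qed
    qed
    have "cos w0 A' \<subseteq> (\<lambda>C. C #> inv a) ` (cos w0 A - {M (Suc w0) #> a})"
    proof
      fix C assume "C \<in> cos w0 A'"
      then obtain \<sigma> x where \<sigma>: "\<sigma> \<in> \<Sigma>" "x \<in> A" and C: "C = M (Suc w0) #> (\<sigma> x \<otimes> inv a)"
        and m: "\<sigma> x \<otimes> inv a \<in> M w0 - M (Suc w0)"
        by (auto simp: cos_def A'_def)
      have "\<not> lev x < w0"
        using low(2)[OF \<sigma>] m anti'[of "Suc (lev x)" w0] by (metis DiffD1 DiffD2 Suc_leI subset_iff)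
      then have v: "lev x = w0" using a_max[OF \<sigma>(2)] w0_def by simp
      then have "M (Suc w0) #> x \<in> cos w0 A"
        using \<sigma>(2) lev[OF xA(1)[OF \<sigma>(2)]] by (auto simp: cos_def)
      then show "C \<in> (\<lambda>C. C #> inv a) ` (cos w0 A - {M (Suc w0) #> a})"
        using top[OF \<sigma> v] m C by blast
    qed
    moreover have fin: "finite (cos w0 A)" using A by (simp add: cos_def)
    ultimately have "card (cos w0 A') \<le> card (cos w0 A - {M (Suc w0) #> a})"
      by (meson card_image_le card_mono finite_Diff finite_imageI le_trans)
    also have "\<dots> < card (cos w0 A)"
    proof (rule psubset_card_mono[OF fin])
      have "M (Suc w0) #> a \<in> cos w0 A"
        using a lev[OF xA(1)[OF a]] by (auto simp: cos_def w0_def)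
      then show "cos w0 A - {M (Suc w0) #> a} \<subset> cos w0 A" by blast
    qed
    finally have less: "card (cos w0 A') < card (cos w0 A)" .
    have split: "[0..<R] = [0..<w0] @ w0 # [Suc w0..<R]"
      using w0 upt_add_eq_append[of 0 w0 "R - w0"] by (simp add: upt_conv_Cons)
    have vec: "pet_vector M R B = map (\<lambda>w. card (cos w B)) [0..<w0] @ card (cos w0 B)
        # map (\<lambda>w. card (cos w B)) [Suc w0..<R]" for B
      unfolding pet_vector_def split cos_def by simp
    have pre: "map (\<lambda>w. card (cos w A')) [0..<w0] = map (\<lambda>w. card (cos w A)) [0..<w0]"
      using same by simp
    have "(pet_vector M R A', pet_vector M R A) \<in> lexn less_than R"
      unfolding lexn_conv mem_Collect_eq case_prod_conv
    proof (intro conjI exI)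
      show "pet_vector M R A = map (\<lambda>w. card (cos w A)) [0..<w0] @ card (cos w0 A)
          # map (\<lambda>w. card (cos w A)) [Suc w0..<R]" by (rule vec)
      show "pet_vector M R A' = map (\<lambda>w. card (cos w A)) [0..<w0] @ card (cos w0 A')
          # map (\<lambda>w. card (cos w A')) [Suc w0..<R]" using vec pre by simp
    qed (use less in \<open>simp_all add: pet_vector_def\<close>)
    then show "(pet_vector M R ({\<sigma> x \<otimes> inv a | \<sigma> x. \<sigma> \<in> \<Sigma> \<and> x \<in> A} - {\<one>}), pet_vector M R A)
            \<in> lexn less_than R"
      unfolding A'_def .
  qed
qed

end

subsection \<open>Syndetic return times\<close>

lemma syndetic_displaced:
  assumes "syndetic S" and "\<And>n. n \<in> S \<Longrightarrow> \<exists>m\<in>S'. \<bar>m - n\<bar> \<le> int L"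
  shows "syndetic S'"
proof -
  obtain N where N: "N \<ge> 1" "\<And>i. {i..i + int N} \<inter> S \<noteq> {}"
    using assms(1) by (auto simp: syndetic_def)
  have "{i..i + int (N + 2 * L)} \<inter> S' \<noteq> {}" for i
  proof -
    obtain n where n: "n \<in> S" "i + int L \<le> n" "n \<le> i + int L + int N"
      using N(2)[of "i + int L"] by auto
    then obtain m where "m \<in> S'" "\<bar>m - n\<bar> \<le> int L" using assms(2) by blast
    then have "m \<in> {i..i + int (N + 2 * L)} \<inter> S'" using n by auto
    then show ?thesis by blast
  qed
  then show ?thesis
    unfolding syndetic_def using N(1) by (intro exI[of _ "N + 2 * L"]) auto
qed

lemma syndetic_mono: "syndetic S \<Longrightarrow> S \<subseteq> S' \<Longrightarrow> syndetic S'"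
  using syndetic_displaced[of S S' 0] by auto

lemma syndetic_avoids_finite:
  assumes "syndetic S" "finite F"
  obtains n where "n \<in> S" "n \<notin> F"
proof -
  obtain N where N: "\<And>i. {i..i + int N} \<inter> S \<noteq> {}"
    using assms(1) by (auto simp: syndetic_def)
  define i where "i = Max (insert 0 F) + 1"
  obtain n where n: "n \<in> S" "i \<le> n" using N[of i] by auto
  have "n \<notin> F"
  proof
    assume "n \<in> F"
    then have "n \<le> Max (insert 0 F)" using assms(2) by simp
    then show False using n(2) by (simp add: i_def)
  qed
  then show thesis using that n(1) by blast
qed

lemma syndetic_UNIV: "syndetic UNIV"
  unfolding syndetic_def by (intro exI[of _ 1] conjI allI) (simp_all add: not_less)

lemma thickly_syndetic_UNIV: "thickly_syndetic UNIV"
  by (simp add: thickly_syndetic_def syndetic_UNIV)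

lemma thickly_syndetic_mono:
  assumes "thickly_syndetic S" "S \<subseteq> S'"
  shows "thickly_syndetic S'"
  unfolding thickly_syndetic_def
proof (intro allI impI)
  fix N :: nat assume "N \<ge> 1"
  then have "syndetic {n. {n..n + int N - 1} \<subseteq> S}"
    using assms(1) by (simp add: thickly_syndetic_def)
  then show "syndetic {n. {n..n + int N - 1} \<subseteq> S'}"
    by (rule syndetic_mono, intro Collect_mono impI) (erule subset_trans, rule assms(2))
qed

lemma thickly_syndetic_imp_syndetic: "thickly_syndetic S \<Longrightarrow> syndetic S"
  unfolding thickly_syndetic_def by (drule spec[of _ 1]) simp

text \<open>If runs of length \<open>N\<close> in \<open>A\<close> begin with gaps at most
  \<open>L\<close>, then any run of length \<open>N + L\<close> in \<open>B\<close> contains one of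
  them entirely.\<close>

lemma thickly_syndetic_Int:
  assumes "thickly_syndetic A" "thickly_syndetic B"
  shows "thickly_syndetic (A \<inter> B)"
  unfolding thickly_syndetic_def
proof (intro allI impI)
  fix N :: nat assume "N \<ge> 1"
  then have "syndetic {n. {n..n + int N - 1} \<subseteq> A}"
    using assms(1) by (simp add: thickly_syndetic_def)
  then obtain L where L: "\<And>i. {i..i + int L} \<inter> {n. {n..n + int N - 1} \<subseteq> A} \<noteq> {}"
    by (auto simp: syndetic_def)
  have "syndetic {n. {n..n + int (N + L) - 1} \<subseteq> B}"
    using assms(2)[unfolded thickly_syndetic_def, rule_format, of "N + L"] \<open>N \<ge> 1\<close> by simp
  then show "syndetic {n. {n..n + int N - 1} \<subseteq> A \<inter> B}"
  proof (rule syndetic_displaced)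
    fix n assume n: "n \<in> {n. {n..n + int (N + L) - 1} \<subseteq> B}"
    obtain m where m: "n \<le> m" "m \<le> n + int L" "{m..m + int N - 1} \<subseteq> A"
      using L[of n] by auto
    then have "{m..m + int N - 1} \<subseteq> B" using n by force
    then show "\<exists>m\<in>{n. {n..n + int N - 1} \<subseteq> A \<inter> B}. \<bar>m - n\<bar> \<le> int L"
      using m by (intro bexI[of _ m]) auto
  qed
qed

lemma thickly_syndetic_INT:
  "finite I \<Longrightarrow> (\<And>i. i \<in> I \<Longrightarrow> thickly_syndetic (A i)) \<Longrightarrow> thickly_syndetic (\<Inter>i\<in>I. A i)"
  by (induction I rule: finite_induct) (auto simp: thickly_syndetic_UNIV intro: thickly_syndetic_Int)

section \<open>Recurrence under a single transformation\<close>

locale mixing_minimal_action = torsion_free_polynomial_sequences G D s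
  for G :: "('g, 'b) monoid_scheme" (structure) and D s +
  fixes \<phi> :: "'g \<Rightarrow> 'x::metric_space \<Rightarrow> 'x"
  assumes act_mult: "g \<in> carrier G \<Longrightarrow> h \<in> carrier G \<Longrightarrow> \<phi> (g \<otimes> h) x = \<phi> g (\<phi> h x)"
    and act_one: "\<phi> \<one> x = x"
    and act_continuous: "g \<in> carrier G \<Longrightarrow> continuous_on UNIV (\<phi> g)"
    and compact: "compact (UNIV :: 'x set)"
    and weakly_mixing: "t \<in> carrier G \<Longrightarrow> t \<noteq> \<one> \<Longrightarrow>
        weakly_mixing_system integer_group (generated_action G \<phi> t)"
    and minimal: "t \<in> carrier G \<Longrightarrow> t \<noteq> \<one> \<Longrightarrow>
        minimal_system integer_group (generated_action G \<phi> t)"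
begin

lemma act_inv: "g \<in> carrier G \<Longrightarrow> \<phi> g (\<phi> (inv g) x) = x"
  using act_mult[of g "inv g" x] by (simp add: act_one)

lemma act_int_pow_add:
  "t \<in> carrier G \<Longrightarrow> \<phi> (t [^] (m + n :: int)) x = \<phi> (t [^] m) (\<phi> (t [^] n) x)"
  by (simp add: int_pow_mult act_mult)

lemma open_preimage:
  assumes "g \<in> carrier G" "open V"
  shows "open {x. \<phi> g x \<in> V}"
  using open_vimage[OF assms(2) act_continuous[OF assms(1)]] by (simp add: vimage_def)

lemma preimage_nonempty:
  assumes "g \<in> carrier G" "V \<noteq> {}"
  shows "{x. \<phi> g x \<in> V} \<noteq> {}"
proof -
  obtain v where "v \<in> V" using assms(2) by blast
  then have "\<phi> (inv g) v \<in> {x. \<phi> g x \<in> V}" by (simp add: act_inv assms(1))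
  then show ?thesis by blast
qed

definition returns :: "'g \<Rightarrow> 'x set \<Rightarrow> 'x set \<Rightarrow> int set" where
  "returns t U V = {n. \<exists>x\<in>U. \<phi> (t [^] n) x \<in> V}"

text \<open>The points whose orbit misses \<open>V\<close> form a closed invariant proper subset,
  which minimality makes empty. Compactness then bounds the time needed to reach
  \<open>V\<close>.\<close>

lemma minimal_cover:
  assumes t: "t \<in> carrier G" "t \<noteq> \<one>" and V: "open V" "V \<noteq> {}"
  obtains L :: nat where "\<And>x. \<exists>j::int. \<bar>j\<bar> \<le> int L \<and> \<phi> (t [^] j) x \<in> V"
proof -
  define C where "C j = {x. \<phi> (t [^] (j::int)) x \<in> V}" for j
  have C: "open (C j)" for j
    unfolding C_def by (rule open_preimage) (use t V in auto)
  have "- (\<Union>j. C j) = {}"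
  proof (rule ccontr)
    assume ne: "- (\<Union>j. C j) \<noteq> {}"
    have "closed (- (\<Union>j. C j))" using C by (intro closed_Compl open_UN) auto
    moreover have "- (\<Union>j. C j) \<subset> UNIV"
    proof -
      have "C 0 \<noteq> {}" using V by (simp add: C_def act_one)
      then show ?thesis by blast
    qed
    moreover have "\<phi> (t [^] (m::int)) x \<in> - (\<Union>j. C j)" if "x \<in> - (\<Union>j. C j)" for m x
      using that by (simp add: C_def t flip: act_int_pow_add)
    then have "invariant_subset integer_group (generated_action G \<phi> t) (- (\<Union>j. C j))"
      by (auto simp: invariant_subset_def generated_action_def)
    ultimately show False
      using minimal[OF t] ne unfolding minimal_system_def by blast
  qed
  then have "UNIV \<subseteq> (\<Union>j\<in>UNIV. C j)" by blast
  then obtain J where J: "finite J" "UNIV \<subseteq> (\<Union>j\<in>J. C j)"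
    using compactE_image[OF compact, of UNIV C] C by metis
  define L where "L = Max (insert 0 ((\<lambda>j. nat \<bar>j\<bar>) ` J))"
  have "\<bar>j\<bar> \<le> int L" if "j \<in> J" for j
  proof -
    have "nat \<bar>j\<bar> \<le> L" unfolding L_def using that J(1) by (intro Max_ge) auto
    then show ?thesis by simp
  qed
  moreover have "\<exists>j\<in>J. \<phi> (t [^] j) x \<in> V" for x
    using J(2) by (auto simp: C_def)
  ultimately show thesis using that by metis
qed

lemma syndetic_returns:
  assumes t: "t \<in> carrier G" "t \<noteq> \<one>" and U: "U \<noteq> {}" and V: "open V" "V \<noteq> {}"
  shows "syndetic (returns t U V)"
proof -
  obtain L :: nat where L: "\<And>x. \<exists>j::int. \<bar>j\<bar> \<le> int L \<and> \<phi> (t [^] j) x \<in> V"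
    using minimal_cover[OF t V] by blast
  obtain x where x: "x \<in> U" using U by blast
  show ?thesis
  proof (rule syndetic_displaced[OF syndetic_UNIV, of _ L])
    fix n :: int
    obtain j where "\<bar>j\<bar> \<le> int L" "\<phi> (t [^] j) (\<phi> (t [^] n) x) \<in> V" using L by blast
    then show "\<exists>m\<in>returns t U V. \<bar>m - n\<bar> \<le> int L"
      using x t by (intro bexI[of _ "j + n"]) (auto simp: returns_def act_int_pow_add)
  qed
qed

text \<open>The translates of \<open>A \<times> C\<close> under the diagonal action have an open
  invariant union, dense by weak mixing, so it meets \<open>B \<times> E\<close>.\<close>

lemma returns_meet:
  assumes t: "t \<in> carrier G" "t \<noteq> \<one>"
    and open_sets: "open A" "A \<noteq> {}" "open B" "B \<noteq> {}" "open C" "C \<noteq> {}" "open E" "E \<noteq> {}"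
  shows "returns t A B \<inter> returns t C E \<noteq> {}"
proof -
  define W where "W = (\<Union>n::int. {x. \<phi> (t [^] n) x \<in> A} \<times> {x. \<phi> (t [^] n) x \<in> C})"
  have "open W"
    unfolding W_def using t open_sets by (intro open_UN ballI open_Times open_preimage) auto
  moreover have "W \<noteq> {}"
  proof -
    obtain x y where "x \<in> A" "y \<in> C" using open_sets by blast
    then have "(x, y) \<in> W"
      unfolding W_def by (intro UN_I[of 0]) (auto simp: act_one)
    then show ?thesis by blast
  qed
  moreover have "invariant_subset integer_group (diagonal_action (generated_action G \<phi> t)) W"
    unfolding invariant_subset_def
  proof (intro ballI subsetI)
    fix m p assume "p \<in> diagonal_action (generated_action G \<phi> t) m ` W"
    then obtain x y n where "p = (\<phi> (t [^] m) x, \<phi> (t [^] m) y)"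
      "\<phi> (t [^] (n::int)) x \<in> A" "\<phi> (t [^] n) y \<in> C"
      by (auto simp: W_def diagonal_action_def generated_action_def)
    moreover have "\<phi> (t [^] (n - m)) (\<phi> (t [^] m) z) = \<phi> (t [^] n) z" for z
      using t by (simp flip: act_int_pow_add)
    ultimately show "p \<in> W" by (auto simp: W_def intro!: exI[of _ "n - m"])
  qed
  ultimately have "closure W = UNIV"
    using weakly_mixing[OF t] by (auto simp: weakly_mixing_system_def transitive_system_def)
  then have "W \<inter> (B \<times> E) \<noteq> {}"
    using open_Int_closure_eq_empty[of "B \<times> E" W] open_sets by (auto simp: open_Times)
  then obtain x y n where xy: "x \<in> B" "y \<in> E" "\<phi> (t [^] (n::int)) x \<in> A" "\<phi> (t [^] n) y \<in> C"
    by (auto simp: W_def)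
  moreover have "\<phi> (t [^] (- n)) (\<phi> (t [^] n) z) = z" for z
    using t by (simp add: act_one flip: act_int_pow_add)
  \<comment> \<open>The point found in \<open>B \<times> E\<close> enters
    \<open>A \<times> C\<close> at time \<open>n\<close>, so the wanted passage takes time
    \<open>- n\<close>.\<close>
  ultimately have "- n \<in> returns t A B \<inter> returns t C E"
    unfolding returns_def
    by (intro IntI CollectI bexI[of _ "\<phi> (t [^] n) x"] bexI[of _ "\<phi> (t [^] n) y"]) simp_all
  then show ?thesis by blast
qed

text \<open>Furstenberg's intersection lemma.\<close>

lemma returns_Int_superset:
  assumes t: "t \<in> carrier G" "t \<noteq> \<one>"
    and open_sets: "open A" "A \<noteq> {}" "open B" "B \<noteq> {}" "open C" "C \<noteq> {}" "open E" "E \<noteq> {}"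
  obtains U V where "open U" "U \<noteq> {}" "open V" "V \<noteq> {}"
    "returns t U V \<subseteq> returns t A B \<inter> returns t C E"
proof -
  \<comment> \<open>This \<open>n\<close> couples the two pairs: if \<open>x\<close> goes from
    \<open>U\<close> to \<open>V\<close> in time \<open>m\<close>, its image under
    \<open>t [^] n\<close> goes from \<open>C\<close> to \<open>E\<close> in the same time, because
    powers of \<open>t\<close> commute.\<close>
  obtain n where n: "n \<in> returns t A C" "n \<in> returns t B E"
    using returns_meet[OF t, of A C B E] open_sets by blast
  define U V where "U = A \<inter> {x. \<phi> (t [^] n) x \<in> C}" and "V = B \<inter> {x. \<phi> (t [^] n) x \<in> E}"
  have "open U" "open V"
    unfolding U_def V_def using t open_sets by (intro open_Int open_preimage; simp)+
  moreover have "U \<noteq> {}" "V \<noteq> {}"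
    using n by (auto simp: U_def V_def returns_def)
  moreover have "m \<in> returns t A B \<inter> returns t C E" if m: "m \<in> returns t U V" for m
  proof -
    obtain x where x: "x \<in> A" "\<phi> (t [^] n) x \<in> C" "\<phi> (t [^] m) x \<in> B"
      "\<phi> (t [^] n) (\<phi> (t [^] m) x) \<in> E"
      using m by (auto simp: returns_def U_def V_def)
    have "\<phi> (t [^] n) (\<phi> (t [^] m) x) = \<phi> (t [^] m) (\<phi> (t [^] n) x)"
      using t by (simp add: add.commute flip: act_int_pow_add)
    then show ?thesis using x by (auto simp: returns_def)
  qed
  ultimately show thesis using that by blast
qed

text \<open>A run of length \<open>N\<close> starting at \<open>n\<close> means that
  \<open>n\<close> is a return time to the preimages of \<open>V\<close> under
  \<open>t [^] j\<close> for all \<open>j < N\<close>. The intersection lemma puts a single set of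
  return times inside these conditions, and minimality makes it syndetic.\<close>

lemma thickly_syndetic_returns:
  assumes t: "t \<in> carrier G" "t \<noteq> \<one>"
    and U: "open U" "U \<noteq> {}" and V: "open V" "V \<noteq> {}"
  shows "thickly_syndetic (returns t U V)"
  unfolding thickly_syndetic_def
proof (intro allI impI)
  fix N :: nat
  have "\<exists>U' V'. open U' \<and> U' \<noteq> {} \<and> open V' \<and> V' \<noteq> {} \<and>
      returns t U' V' \<subseteq> (\<Inter>j<N. returns t U {x. \<phi> (t [^] int j) x \<in> V})"
  proof (induction N)
    case 0
    then show ?case using U V by auto
  next
    case (Suc N)
    then obtain U' V' where *: "open U'" "U' \<noteq> {}" "open V'" "V' \<noteq> {}"
      "returns t U' V' \<subseteq> (\<Inter>j<N. returns t U {x. \<phi> (t [^] int j) x \<in> V})"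
      by blast
    have VN: "open {x. \<phi> (t [^] int N) x \<in> V}" "{x. \<phi> (t [^] int N) x \<in> V} \<noteq> {}"
      using open_preimage[of "t [^] int N" V] preimage_nonempty[of "t [^] int N" V] t V by auto
    obtain U'' V'' where "open U''" "U'' \<noteq> {}" "open V''" "V'' \<noteq> {}"
      "returns t U'' V'' \<subseteq> returns t U' V' \<inter> returns t U {x. \<phi> (t [^] int N) x \<in> V}"
      using returns_Int_superset[OF t *(1-4) U VN] by blast
    then show ?case
      using *(5) by (intro exI[of _ U''] exI[of _ V'']) (auto simp: lessThan_Suc)
  qed
  then obtain U' V' where UV': "open U'" "U' \<noteq> {}" "open V'" "V' \<noteq> {}"
    "returns t U' V' \<subseteq> (\<Inter>j<N. returns t U {x. \<phi> (t [^] int j) x \<in> V})"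
    by blast
  show "syndetic {n. {n..n + int N - 1} \<subseteq> returns t U V}"
  proof (rule syndetic_mono[OF syndetic_returns[OF t UV'(2-4)]], intro subsetI CollectI)
    fix n m assume n: "n \<in> returns t U' V'" and m: "m \<in> {n..n + int N - 1}"
    define j where "j = nat (m - n)"
    have "j < N" and mj: "m = int j + n" using m by (auto simp: j_def)
    then have "n \<in> returns t U {x. \<phi> (t [^] int j) x \<in> V}" using n UV'(5) by blast
    then show "m \<in> returns t U V"
      using t unfolding mj by (auto simp: returns_def act_int_pow_add)
  qed
qed

lemma thickly_syndetic_power_seq:
  assumes f: "f \<in> plevel 0 - {\<one>\<^bsub>SG\<^esub>}" "power_seq f"
    and U: "open U" "U \<noteq> {}" and V: "open V" "V \<noteq> {}"
  shows "thickly_syndetic {n. \<exists>x\<in>U. \<phi> (f n) x \<in> V}"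
proof -
  obtain r where r: "r \<in> carrier G" "f = (\<lambda>n. r [^] n)"
    using f(2) by (auto simp: power_seq_def)
  have "r \<noteq> \<one>" using f(1) r by (auto simp: one_seq_group)
  then show ?thesis
    using thickly_syndetic_returns[OF r(1) _ U V] r(2) by (simp add: returns_def)
qed

section \<open>Multiple recurrence by PET induction\<close>

text \<open>The shifts are chosen one after another. Collisions between different sequences exclude
  only finitely many values. A power sequence has all its shifts equal, so its targets must be met
  by one point \<open>y\<close>; each such sequence allows a thickly syndetic set of next shifts,
  and finitely many of these sets intersect.\<close>

lemma exists_separating_shifts:
  assumes A: "finite A" "A \<subseteq> plevel 0 - {\<one>\<^bsub>SG\<^esub>}"
    and V: "\<And>f. f \<in> A \<Longrightarrow> open (V f) \<and> V f \<noteq> {}"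
    and z: "z \<in> carrier G"
  shows "\<exists>k :: nat \<Rightarrow> int. inj_on k {..<m} \<and>
      (\<forall>i<m. \<forall>j<m. \<forall>f\<in>A. \<forall>h\<in>A. sigma (k i) f = sigma (k j) h \<longrightarrow> f = h) \<and>
      (\<forall>f\<in>A. power_seq f \<longrightarrow> (\<exists>y. \<forall>j<m. \<phi> (f (k j)) (\<phi> (z [^] (- int j)) y) \<in> V f))"
proof (induction m)
  case 0
  then show ?case by auto
next
  case (Suc m)
  then obtain k :: "nat \<Rightarrow> int" where k: "inj_on k {..<m}"
    and sep: "\<And>i j f h. i < m \<Longrightarrow> j < m \<Longrightarrow> f \<in> A \<Longrightarrow> h \<in> A \<Longrightarrow> sigma (k i) f = sigma (k j) h \<Longrightarrow> f = h"
    and ex: "\<And>f. f \<in> A \<Longrightarrow> power_seq f \<Longrightarrow>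
        \<exists>y. \<forall>j<m. \<phi> (f (k j)) (\<phi> (z [^] (- int j)) y) \<in> V f"
    by blast
  \<comment> \<open>The forbidden values: earlier shifts, and those at which a sequence would
    collide with an earlier shift of another one.\<close>
  define F where "F = k ` {..<m} \<union>
      (\<Union>(f, h, j) \<in> {(f, h, j). f \<in> A \<and> h \<in> A \<and> j < m \<and> f \<noteq> h}. {l. sigma l f = sigma (k j) h})"
  have "finite {(f, h, j). f \<in> A \<and> h \<in> A \<and> j < m \<and> f \<noteq> h}"
    by (rule finite_subset[of _ "A \<times> A \<times> {..<m}"]) (use A in auto)
  moreover have "finite {l. sigma l f = sigma (k j) h}" if "f \<in> A" "h \<in> A" "f \<noteq> h" for f h j
    using that A(2) by (intro finite_sigma_collisions) auto
  ultimately have F: "finite F"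
    unfolding F_def by (intro finite_UnI finite_UN_I) auto
  \<comment> \<open>The earlier conditions on \<open>y\<close> in terms of \<open>x\<close>, where
    \<open>y\<close> is \<open>z [^] m\<close> applied to \<open>x\<close>; the new condition for
    \<open>j = m\<close> then concerns \<open>x\<close> itself.\<close>
  define W where "W f = {y. \<forall>j<m. \<phi> (f (k j)) (\<phi> (z [^] (int m - int j)) y) \<in> V f}" for f
  have zc: "z [^] (i::int) \<in> carrier G" for i using z by simp
  have W: "open (W f)" "W f \<noteq> {}" if f: "f \<in> A" "power_seq f" for f
  proof -
    have fc: "f n \<in> carrier G" for n using plevel_closed f A by blast
    have "W f = (\<Inter>j<m. {y. \<phi> (z [^] (int m - int j)) y \<in> {y. \<phi> (f (k j)) y \<in> V f}})"
      by (auto simp: W_def)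
    also have "open \<dots>"
      using V[OF f(1)] fc zc by (intro open_INT ballI open_preimage) auto
    finally show "open (W f)" .
    obtain y where y: "\<forall>j<m. \<phi> (f (k j)) (\<phi> (z [^] (- int j)) y) \<in> V f"
      using ex f by blast
    have "\<phi> (z [^] (int m - int j)) (\<phi> (z [^] (- int m)) y) = \<phi> (z [^] (- int j)) y" for j
      using z by (simp flip: act_int_pow_add)
    then have "\<phi> (z [^] (- int m)) y \<in> W f" using y by (simp add: W_def)
    then show "W f \<noteq> {}" by blast
  qed
  have "thickly_syndetic (\<Inter>f\<in>{f\<in>A. power_seq f}. {n. \<exists>x\<in>W f. \<phi> (f n) x \<in> V f})"
    using A W V by (intro thickly_syndetic_INT thickly_syndetic_power_seq) auto
  then obtain l where lI: "l \<in> (\<Inter>f\<in>{f\<in>A. power_seq f}. {n. \<exists>x\<in>W f. \<phi> (f n) x \<in> V f})"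
    and l: "l \<notin> F"
    by (rule syndetic_avoids_finite[OF thickly_syndetic_imp_syndetic F])
  have lW: "\<exists>x\<in>W f. \<phi> (f l) x \<in> V f" if "f \<in> A" "power_seq f" for f
    using lI that by auto
  define k' where "k' = k(m := l)"
  have "inj_on k' {..<Suc m}"
    using k l by (auto simp: k'_def F_def inj_on_def less_Suc_eq)
  moreover have "f = h" if ij: "i < Suc m" "j < Suc m" "f \<in> A" "h \<in> A" "sigma (k' i) f = sigma (k' j) h" for i j f h
  proof -
    consider "i < m" "j < m" | "i = m" "j < m" | "i < m" "j = m" | "i = m" "j = m"
      using ij(1,2) less_Suc_eq by blast
    then show ?thesis
    proof cases
      case 1
      then show ?thesis using sep ij by (simp add: k'_def)
    next
      case 2
      then have "sigma l f = sigma (k j) h" using ij by (simp add: k'_def)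
      then show ?thesis using l ij(3,4) 2 by (auto simp: F_def)
    next
      case 3
      then have "sigma l h = sigma (k i) f" using ij by (simp add: k'_def)
      then show ?thesis using l ij(3,4) 3 by (auto simp: F_def)
    next
      case 4
      then show ?thesis using sigma_inj[of f h l] A ij by (auto simp: k'_def)
    qed
  qed
  moreover have "\<exists>y. \<forall>j<Suc m. \<phi> (f (k' j)) (\<phi> (z [^] (- int j)) y) \<in> V f" if f: "f \<in> A" "power_seq f" for f
  proof -
    obtain x where x: "x \<in> W f" "\<phi> (f l) x \<in> V f" using lW f by blast
    have "\<phi> (z [^] (- int j)) (\<phi> (z [^] int m) x) = \<phi> (z [^] (int m - int j)) x" for j
      using z by (simp flip: act_int_pow_add)
    moreover have "\<phi> (z [^] (int m - int m)) x = x" by (simp add: act_one)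
    ultimately show ?thesis
      using x by (intro exI[of _ "\<phi> (z [^] int m) x"]) (auto simp: k'_def W_def less_Suc_eq)
  qed
  ultimately show ?case by blast
qed

lemma pet_vector_wf:
  "wf (inv_image (lexn less_than (Suc (s * D))) (S.pet_vector plevel (Suc (s * D))))"
  by (intro wf_inv_image wf_lexn wf_less_than)

text \<open>The sets \<open>U\<close> and \<open>V\<close> vary in the induction, because the
  smaller family is applied to new target sets that encode the cover of the space by translates of
  \<open>U\<close>.\<close>

theorem syndetic_multiple_returns:
  assumes "finite A" "A \<subseteq> plevel 0 - {\<one>\<^bsub>SG\<^esub>}"
    and "open U" "U \<noteq> {}"
    and "\<And>f. f \<in> A \<Longrightarrow> open (V f) \<and> V f \<noteq> {}"
  shows "syndetic {n. \<exists>x\<in>U. \<forall>f\<in>A. \<phi> (f n) x \<in> V f}"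
  using assms
proof (induction A arbitrary: U V
    rule: wf_induct_rule[OF pet_vector_wf, case_names less])
  case (less A)
  show ?case
  proof (cases "A = {}")
    case True
    then show ?thesis using less.prems by (auto simp: syndetic_UNIV)
  next
    case False
    have closed: "f n \<in> carrier G" if "f \<in> A" for f n
      using plevel_closed that less.prems(2) by blast
    obtain a where a: "a \<in> A" and decreases: "\<And>\<Sigma>. \<lbrakk>\<Sigma> \<noteq> {};
        \<And>\<sigma> x w. \<sigma> \<in> \<Sigma> \<Longrightarrow> x \<in> plevel w \<Longrightarrow> \<sigma> x \<otimes>\<^bsub>SG\<^esub> inv\<^bsub>SG\<^esub> x \<in> plevel (Suc w);
        \<And>\<sigma> x. \<sigma> \<in> \<Sigma> \<Longrightarrow> x \<in> plevel 0 \<Longrightarrow> \<sigma> x \<in> carrier SG\<rbrakk> \<Longrightarrow>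
      (S.pet_vector plevel (Suc (s * D))
          ({\<sigma> x \<otimes>\<^bsub>SG\<^esub> inv\<^bsub>SG\<^esub> a | \<sigma> x. \<sigma> \<in> \<Sigma> \<and> x \<in> A} - {\<one>\<^bsub>SG\<^esub>}),
        S.pet_vector plevel (Suc (s * D)) A) \<in> lexn less_than (Suc (s * D))"
      using S.pet_vector_decreases[of plevel "Suc (s * D)" A] subgroup_plevel
        plevel_antimono[OF le_SucI[OF order_refl]] plevel_conj plevel_eventually_trivial
        less.prems(1,2) False by blast
    have aP: "a \<in> plevel 0" using a less.prems(2) by blast
    have inv_aP: "inv\<^bsub>SG\<^esub> a \<in> plevel 0"
      by (rule subgroup.m_inv_closed[OF subgroup_plevel aP])
    \<comment> \<open>A nontrivial value of \<open>a\<close> shows that the group is nontrivial,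
      hence has a nontrivial central element.\<close>
    obtain t where t: "t \<in> carrier G" "t \<noteq> \<one>"
    proof -
      have "a \<noteq> (\<lambda>_. \<one>)" using a less.prems(2) by (auto simp: one_seq_group)
      then obtain n where "a n \<noteq> \<one>" by auto
      then show thesis using that closed[OF a] by blast
    qed
    have "nilpotent_group G"
      using nilpotent is_group by (auto simp: nilpotent_group_def)
    then obtain z where z: "z \<in> carrier G" "z \<noteq> \<one>"
      and central: "\<And>g. g \<in> carrier G \<Longrightarrow> z \<otimes> g = g \<otimes> z"
      using nilpotent_group_central_element[OF _ t] by blast
    have zc: "z [^] (i::int) \<in> carrier G" for i using z by simp
    have central_pow: "z [^] (i::int) \<otimes> g = g \<otimes> z [^] i" if "g \<in> carrier G" for i g
      using int_pow_commute[OF z(1) that] central[OF that] by simp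
    obtain L where L: "\<And>x. \<exists>j::int. \<bar>j\<bar> \<le> int L \<and> \<phi> (z [^] j) x \<in> U"
      using minimal_cover[OF z less.prems(3,4)] by blast
    \<comment> \<open>Starting from \<open>z [^] (- int L)\<close> turns the exponents from
      \<open>- L\<close> to \<open>L\<close> into \<open>- j\<close> with \<open>j\<close> from 0 to
      \<open>2 * L\<close>.\<close>
    define m where "m = Suc (2 * L)"
    have cover: "\<exists>j<m. \<phi> (z [^] (- int j)) x \<in> U" for x
    proof -
      obtain i where i: "\<bar>i\<bar> \<le> int L" "\<phi> (z [^] i) (\<phi> (z [^] (- int L)) x) \<in> U" using L by blast
      have "nat (int L - i) < m" "z [^] (i + - int L) = z [^] (- int (nat (int L - i)))"
        using i(1) by (auto simp: m_def)
      then show ?thesis using i(2) z by (metis act_int_pow_add)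
    qed
    obtain k :: "nat \<Rightarrow> int" where k: "inj_on k {..<m}"
      and sep: "\<And>i j f h. i < m \<Longrightarrow> j < m \<Longrightarrow> f \<in> A \<Longrightarrow> h \<in> A \<Longrightarrow> sigma (k i) f = sigma (k j) h \<Longrightarrow> f = h"
      and ex: "\<And>f. f \<in> A \<Longrightarrow> power_seq f \<Longrightarrow>
        \<exists>y. \<forall>j<m. \<phi> (f (k j)) (\<phi> (z [^] (- int j)) y) \<in> V f"
      using exists_separating_shifts[where V = V and m = m, OF less.prems(1,2,5) z(1)] by blast
    \<comment> \<open>Chosen so that \<open>f (n + k j)\<close> is the product of
      \<open>f (k j)\<close>, \<open>E j f n\<close> and \<open>a n\<close>.\<close>
    define E where "E j f = sigma (k j) f \<otimes>\<^bsub>SG\<^esub> inv\<^bsub>SG\<^esub> a" for j f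
    define A' where "A' = {\<sigma> x \<otimes>\<^bsub>SG\<^esub> inv\<^bsub>SG\<^esub> a | \<sigma> x. \<sigma> \<in> (\<lambda>j. sigma (k j)) ` {..<m} \<and> x \<in> A} - {\<one>\<^bsub>SG\<^esub>}"
    have A'_eq: "A' = (\<Union>j<m. E j ` A) - {\<one>\<^bsub>SG\<^esub>}"
      by (auto simp: A'_def E_def)
    \<comment> \<open>Several pairs of a shift and a sequence may give the same \<open>e\<close>,
      whose target must serve them all. If no pair gives \<open>e\<close>, the intersection is the
      whole space.\<close>
    define V' where "V' e = (\<Inter>j\<in>{..<m}. \<Inter>f\<in>{f\<in>A. E j f = e}.
        {y. \<phi> (z [^] (- int j)) y \<in> {y. \<phi> (f (k j)) y \<in> V f}})" for e
    have E_inj: "sigma (k i) f = sigma (k j) h" if "i < m" "j < m" "f \<in> A" "h \<in> A" "E i f = E j h" for i j f h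
    proof -
      have "sigma (k i) f \<in> carrier SG" "sigma (k j) h \<in> carrier SG" "inv\<^bsub>SG\<^esub> a \<in> carrier SG"
        using that(3,4) closed inv_aP plevel_closed by (auto simp: sigma_def carrier_seq_group)
      then show ?thesis using that(5) S.right_cancel by (simp add: E_def)
    qed
    \<comment> \<open>By separation \<open>e\<close> determines \<open>f\<close>. For a power
      sequence the common point \<open>y\<close> from the choice of shifts lies in all the sets;
      otherwise \<open>e\<close> determines \<open>j\<close> too, and the target is a single
      preimage.\<close>
    have V': "open (V' e) \<and> V' e \<noteq> {}" for e
    proof
      show "open (V' e)"
        unfolding V'_def using less.prems(1,5) closed zc
        by (intro open_INT ballI open_preimage) auto
      show "V' e \<noteq> {}"
      proof (cases "\<exists>j<m. \<exists>f\<in>A. E j f = e")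
        case False
        then have "V' e = UNIV" by (auto simp: V'_def)
        then show ?thesis by simp
      next
        case True
        then obtain j f where jf: "j < m" "f \<in> A" "E j f = e" by blast
        have eq: "h = f" if "i < m" "h \<in> A" "E i h = e" for i h
          using E_inj[of i j h f] sep[of i j h f] that jf by simp
        show ?thesis
        proof (cases "power_seq f")
          case True
          then obtain y where "\<forall>j<m. \<phi> (f (k j)) (\<phi> (z [^] (- int j)) y) \<in> V f"
            using ex jf by blast
          then have "y \<in> V' e" using eq by (auto simp: V'_def)
          then show ?thesis by blast
        next
          case False
          have eq_j: "i = j" if "i < m" "h \<in> A" "E i h = e" for i h
          proof (rule ccontr)
            assume "i \<noteq> j"
            then have "k i \<noteq> k j" using k that(1) jf(1) by (auto dest: inj_onD)
            moreover have "sigma (k i) f = sigma (k j) f"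
              using E_inj[of i j h f] eq[OF that] that jf by simp
            ultimately show False
              using sigma_collision[of f] False jf(2) less.prems(2) by blast
          qed
          have "f (k j) \<otimes> z [^] (- int j) \<in> carrier G" using closed[OF jf(2)] zc by simp
          then have "{y. \<phi> (f (k j) \<otimes> z [^] (- int j)) y \<in> V f} \<noteq> {}"
            using preimage_nonempty less.prems(5)[OF jf(2)] by blast
          then obtain y where "\<phi> (f (k j)) (\<phi> (z [^] (- int j)) y) \<in> V f"
            using closed[OF jf(2)] zc by (auto simp: act_mult)
          then have "y \<in> V' e" using eq eq_j by (auto simp: V'_def)
          then show ?thesis by blast
        qed
      qed
    qed
    have synd: "syndetic {n. \<exists>w\<in>V' \<one>\<^bsub>SG\<^esub>. \<forall>e\<in>A'. \<phi> (e n) w \<in> V' e}"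
    proof (rule less.IH)
      have "(S.pet_vector plevel (Suc (s * D)) A', S.pet_vector plevel (Suc (s * D)) A)
          \<in> lexn less_than (Suc (s * D))"
        unfolding A'_def
      proof (rule decreases)
        show "(\<lambda>j. sigma (k j)) ` {..<m} \<noteq> {}" by (auto simp: m_def)
        fix \<sigma> assume "\<sigma> \<in> (\<lambda>j. sigma (k j)) ` {..<m}"
        then obtain j where \<sigma>: "\<sigma> = sigma (k j)" by blast
        show "\<sigma> x \<otimes>\<^bsub>SG\<^esub> inv\<^bsub>SG\<^esub> x \<in> plevel (Suc w)" if "x \<in> plevel w" for x w
          unfolding \<sigma> using that by (rule sigma_displacement)
        show "\<sigma> x \<in> carrier SG" if "x \<in> plevel 0" for x
          unfolding \<sigma> using plevel_closed[OF sigma_plevel[OF that]] by (simp add: carrier_seq_group)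
      qed
      then show "(A', A) \<in> inv_image (lexn less_than (Suc (s * D))) (S.pet_vector plevel (Suc (s * D)))"
        by simp
      show "finite A'" using less.prems(1) by (simp add: A'_eq)
      have "E j f \<in> plevel 0" if "f \<in> A" for j f
        unfolding E_def using that less.prems(2)
        by (intro subgroup.m_closed[OF subgroup_plevel] sigma_plevel inv_aP) auto
      then show "A' \<subseteq> plevel 0 - {\<one>\<^bsub>SG\<^esub>}" by (auto simp: A'_eq)
    qed (use V' in auto)
    define B where "B = Max (insert 0 ((\<lambda>j. nat \<bar>k j\<bar>) ` {..<m}))"
    show ?thesis
    proof (rule syndetic_displaced[OF synd, where L = B])
      fix n assume "n \<in> {n. \<exists>w\<in>V' \<one>\<^bsub>SG\<^esub>. \<forall>e\<in>A'. \<phi> (e n) w \<in> V' e}"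
      then obtain w where w: "w \<in> V' \<one>\<^bsub>SG\<^esub>" "\<And>e. e \<in> A' \<Longrightarrow> \<phi> (e n) w \<in> V' e" by blast
      \<comment> \<open>Undoing \<open>a n\<close> at the start cancels the division by
        \<open>a\<close>. Only now is \<open>j\<close> chosen, according to which translate of
        \<open>U\<close> contains \<open>y\<close>; all \<open>j\<close> were prepared for at
        once.\<close>
      define y where "y = \<phi> (inv (a n)) w"
      obtain j where j: "j < m" "\<phi> (z [^] (- int j)) y \<in> U" using cover by blast
      have "\<phi> (f (n + k j)) (\<phi> (z [^] (- int j)) y) \<in> V f" if f: "f \<in> A" for f
      proof -
        have "\<phi> (E j f n) w \<in> V' (E j f)"
        proof (cases "E j f = \<one>\<^bsub>SG\<^esub>")
          case True
          then show ?thesis using w(1) by (simp add: one_seq_group act_one)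
        next
          case False
          then show ?thesis using w(2) f j(1) by (auto simp: A'_eq)
        qed
        then have 1: "\<phi> (f (k j)) (\<phi> (z [^] (- int j)) (\<phi> (E j f n) w)) \<in> V f"
          using f j(1) by (auto simp: V'_def)
        have Ec: "E j f n = inv (f (k j)) \<otimes> f (n + k j) \<otimes> inv (a n)"
          using closed[OF a] by (simp add: E_def mult_seq_group inv_seq_group carrier_seq_group sigma_def)
        \<comment> \<open>Centrality moves the power of \<open>z\<close> past
          \<open>E j f n\<close>, so that \<open>f (k j)\<close> can cancel, and then back past
          \<open>inv (a n)\<close> to act on \<open>y\<close>.\<close>
        have "f (k j) \<otimes> (z [^] (- int j) \<otimes> E j f n) = f (k j) \<otimes> (E j f n \<otimes> z [^] (- int j))"
          using closed[OF a] closed[OF f] by (subst central_pow) (auto simp: Ec)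
        also have "\<dots> = f (n + k j) \<otimes> (inv (a n) \<otimes> z [^] (- int j))"
          using closed[OF a] closed[OF f] zc unfolding Ec by (simp add: word_simps del: int_pow_neg)
        also have "\<dots> = f (n + k j) \<otimes> (z [^] (- int j) \<otimes> inv (a n))"
          using closed[OF a] by (subst central_pow) auto
        finally have "\<phi> (f (k j) \<otimes> (z [^] (- int j) \<otimes> E j f n)) w
            = \<phi> (f (n + k j) \<otimes> (z [^] (- int j) \<otimes> inv (a n))) w" by simp
        then show ?thesis
          using 1 closed[OF a] closed[OF f] zc by (simp add: y_def act_mult Ec del: int_pow_neg)
      qed
      moreover have "\<bar>k j\<bar> \<le> int B"
      proof -
        have "nat \<bar>k j\<bar> \<le> B" unfolding B_def using j(1) by (intro Max_ge) auto
        then show ?thesis by simp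
      qed
      ultimately show "\<exists>l\<in>{n. \<exists>x\<in>U. \<forall>f\<in>A. \<phi> (f n) x \<in> V f}. \<bar>l - n\<bar> \<le> int B"
        using j(2) by (intro bexI[of _ "n + k j"]) auto
    qed
  qed
qed

text \<open>For \<open>f\<close> not a power sequence the shifts \<open>sigma i f\<close> are
  distinct and nontrivial. As \<open>f (n + i)\<close> is \<open>f (i)\<close> times
  \<open>sigma i f n\<close>, simultaneous returns of the first \<open>N\<close> of them to the
  preimages of \<open>V\<close> under \<open>f i\<close> give a run of length
  \<open>N\<close>.\<close>

lemma thickly_syndetic_single_returns:
  assumes f: "f \<in> plevel 0 - {\<one>\<^bsub>SG\<^esub>}"
    and U: "open U" "U \<noteq> {}" and V: "open V" "V \<noteq> {}"
  shows "thickly_syndetic {n. \<exists>x\<in>U. \<phi> (f n) x \<in> V}"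
proof (cases "power_seq f")
  case True
  then show ?thesis using thickly_syndetic_power_seq assms by blast
next
  case False
  have fP: "f \<in> plevel 0" and f1: "f \<noteq> \<one>\<^bsub>SG\<^esub>" using f by auto
  have fc: "f n \<in> carrier G" for n using plevel_closed fP by blast
  have inj: "i = j" if "sigma i f = sigma j f" for i j
    using sigma_collision[OF fP that] False by blast
  have ne: "sigma i f \<noteq> \<one>\<^bsub>SG\<^esub>" for i
  proof
    assume "sigma i f = \<one>\<^bsub>SG\<^esub>"
    moreover have "sigma i \<one>\<^bsub>SG\<^esub> = \<one>\<^bsub>SG\<^esub>" by (simp add: sigma_def one_seq_group)
    ultimately show False
      using sigma_inj[OF fP subgroup.one_closed[OF subgroup_plevel], of i] f1 by simp
  qed
  \<comment> \<open>Targets are indexed by sequences in \<open>syndetic_multiple_returns\<close>; as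
    the shifts are distinct, each intersection over a shift has one member.\<close>
  define V' where "V' e = (\<Inter>i\<in>{i. sigma i f = e}. {x. \<phi> (f i) x \<in> V})" for e
  have V'_sigma: "V' (sigma i f) = {x. \<phi> (f i) x \<in> V}" for i
    using inj by (auto simp: V'_def)
  have V'_sigma_open: "open (V' (sigma i f))" "V' (sigma i f) \<noteq> {}" for i
    unfolding V'_sigma using open_preimage[OF fc V(1)] preimage_nonempty[OF fc V(2)] by blast+
  show ?thesis
    unfolding thickly_syndetic_def
  proof (intro allI impI)
    fix N :: nat
    have "syndetic {n. \<exists>x\<in>U. \<forall>e\<in>(\<lambda>i. sigma (int i) f) ` {..<N}. \<phi> (e n) x \<in> V' e}"
      using U ne sigma_plevel[OF fP] V'_sigma_open by (intro syndetic_multiple_returns) auto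
    then show "syndetic {n. {n..n + int N - 1} \<subseteq> {n. \<exists>x\<in>U. \<phi> (f n) x \<in> V}}"
    proof (rule syndetic_mono, intro subsetI CollectI)
      fix n l
      assume n: "n \<in> {n. \<exists>x\<in>U. \<forall>e\<in>(\<lambda>i. sigma (int i) f) ` {..<N}. \<phi> (e n) x \<in> V' e}"
        and l: "l \<in> {n..n + int N - 1}"
      define i where "i = nat (l - n)"
      have i: "i < N" "l = n + int i" using l by (auto simp: i_def)
      obtain x where "x \<in> U" "\<phi> (sigma (int i) f n) x \<in> V' (sigma (int i) f)"
        using n i(1) by blast
      then have "x \<in> U" "\<phi> (f (int i)) (\<phi> (sigma (int i) f n) x) \<in> V" by (auto simp: V'_sigma)
      moreover have "f (int i) \<otimes> sigma (int i) f n = f l"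
        using fc by (simp add: sigma_def i(2) inv_cancel_left)
      ultimately have "x \<in> U" "\<phi> (f l) x \<in> V"
        using fc act_mult[of "f (int i)" "sigma (int i) f n" x] by (auto simp: sigma_def)
      then show "\<exists>x\<in>U. \<phi> (f l) x \<in> V" by blast
    qed
  qed
qed

end

section \<open>Torsion elements and the conclusion\<close>

text \<open>Orbits of a torsion element are finite, so by minimality the space is one finite orbit.
  Its square is then discrete, the diagonal is a nonempty open invariant set, and weak mixing makes
  it dense; being closed, it is everything.\<close>

lemma torsion_imp_singleton:
  fixes G (structure) and \<phi> :: "'g \<Rightarrow> 'x::metric_space \<Rightarrow> 'x"
  assumes "group_action G UNIV \<phi>"
    and t: "t \<in> carrier G"
    and wm: "weakly_mixing_system integer_group (generated_action G \<phi> t)"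
    and min: "minimal_system integer_group (generated_action G \<phi> t)"
    and m: "t [^]\<^bsub>G\<^esub> (m::int) = \<one>\<^bsub>G\<^esub>" "m \<noteq> 0"
  shows "(x::'x) = y"
proof -
  interpret group_action G UNIV \<phi> by fact
  interpret group G using group_hom group_hom.axioms(1) by blast
  have act: "\<phi> (t [^] (i + j :: int)) z = \<phi> (t [^] i) (\<phi> (t [^] j) z)" for i j z
    using t by (simp add: int_pow_mult composition_rule)
  have period: "t [^] (i mod m) = t [^] i" for i :: int
  proof -
    have "t [^] i = t [^] (i mod m) \<otimes> (t [^] m) [^] (i div m)"
      using t by (simp add: int_pow_pow flip: int_pow_mult)
    then show ?thesis using t m(1) by simp
  qed
  define orb where "orb = range (\<lambda>i::int. \<phi> (t [^] i) x)"
  have "orb \<subseteq> (\<lambda>i. \<phi> (t [^] i) x) ` {- \<bar>m\<bar>..\<bar>m\<bar>}"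
  proof
    fix z assume "z \<in> orb"
    then obtain i :: int where "z = \<phi> (t [^] (i mod m)) x"
      by (auto simp: orb_def period)
    moreover have "i mod m \<in> {- \<bar>m\<bar>..\<bar>m\<bar>}"
      using abs_mod_less[OF m(2), of i] by (simp add: abs_le_iff) linarith
    ultimately show "z \<in> (\<lambda>i. \<phi> (t [^] i) x) ` {- \<bar>m\<bar>..\<bar>m\<bar>}" by blast
  qed
  then have fin: "finite orb" by (rule finite_subset) simp
  have "invariant_subset integer_group (generated_action G \<phi> t) orb"
    unfolding invariant_subset_def generated_action_def orb_def by (auto simp flip: act)
  moreover have "orb \<noteq> {}" by (simp add: orb_def)
  ultimately have "\<not> orb \<subset> UNIV"
    using min finite_imp_closed[OF fin] unfolding minimal_system_def by blast
  then have finite_UNIV: "finite (UNIV :: 'x set)" using fin by (simp add: psubset_eq)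
  then have fin2: "finite (A :: ('x \<times> 'x) set)" for A
    by (metis finite_Prod_UNIV finite_subset top_greatest)
  have "open (A :: ('x \<times> 'x) set)" for A
    using finite_imp_closed[OF fin2[of "- A"]] by (simp add: closed_def)
  moreover have "invariant_subset integer_group (diagonal_action (generated_action G \<phi> t)) (range (\<lambda>z. (z, z)))"
    by (auto simp: invariant_subset_def diagonal_action_def)
  moreover have "range (\<lambda>z::'x. (z, z)) \<noteq> {}" by simp
  ultimately have "closure (range (\<lambda>z::'x. (z, z))) = UNIV"
    using wm unfolding weakly_mixing_system_def transitive_system_def by blast
  then have "(x, y) \<in> range (\<lambda>z. (z, z))"
    using closure_closed[OF finite_imp_closed[OF fin2]] by blast
  then show ?thesis by auto
qed

theorem theorem1p3:
  fixes G :: "('g, 'b) monoid_scheme"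
    and \<tau> :: "'g topology"
    and \<phi> :: "'g \<Rightarrow> 'x::metric_space \<Rightarrow> 'x"
    and d k :: nat
    and T :: "nat \<Rightarrow> 'g"
    and p :: "nat \<Rightarrow> nat \<Rightarrow> rat poly"
    and g :: "nat \<Rightarrow> int \<Rightarrow> 'g"
    and U :: "'x set"
    and Us Vs :: "nat \<Rightarrow> 'x set"
  assumes "topological_dynamical_system G \<tau> \<phi>"
    and "nilpotent_group G"
    and "\<And>t. t \<in> carrier G \<Longrightarrow> t \<noteq> \<one>\<^bsub>G\<^esub> \<Longrightarrow>
           weakly_mixing_system integer_group (generated_action G \<phi> t) \<and>
           minimal_system integer_group (generated_action G \<phi> t)"
    and "d \<ge> 1" and "k \<ge> 1"
    and "\<And>j. j \<in> {1..d} \<Longrightarrow> T j \<in> carrier G"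
    and "\<And>i j. i \<in> {1..k} \<Longrightarrow> j \<in> {1..d} \<Longrightarrow> p i j \<in> integral_polys_0"
    and "\<And>i n. i \<in> {1..k} \<Longrightarrow> g i n = polynomial_product G d T (p i) n"
    and "\<And>i. i \<in> {1..k} \<Longrightarrow> depends_nontrivially (g i)"
    and "\<And>i j. i \<in> {1..k} \<Longrightarrow> j \<in> {1..k} \<Longrightarrow> i \<noteq> j \<Longrightarrow>
           depends_nontrivially (\<lambda>n. g i n \<otimes>\<^bsub>G\<^esub> inv\<^bsub>G\<^esub> (g j n))"
    and "open U" and "U \<noteq> {}"
    and "\<And>i. i \<in> {1..k} \<Longrightarrow> open (Us i) \<and> Us i \<noteq> {}"
    and "\<And>i. i \<in> {1..k} \<Longrightarrow> open (Vs i) \<and> Vs i \<noteq> {}"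
  shows "thickly_syndetic
           {n. (\<Pi>\<^sub>E i\<in>{1..k}. Us i) \<inter>
               (\<lambda>x. \<lambda>i\<in>{1..k}. \<phi> (inv\<^bsub>G\<^esub> (g i n)) (x i)) ` (\<Pi>\<^sub>E i\<in>{1..k}. Vs i) \<noteq> {}}
       \<and> syndetic
           {n. U \<inter> (\<Inter>i\<in>{1..k}. \<phi> (inv\<^bsub>G\<^esub> (g i n)) ` Vs i) \<noteq> {}}"
proof (cases "\<forall>x y :: 'x. x = y")
  \<comment> \<open>Over a one-point space the group may have torsion, so this case is separate;
    there every nonempty set is the whole space and every \<open>n\<close> is a return time.\<close>
  case True
  then have UNIV: "A = UNIV" if "A \<noteq> {}" for A :: "'x set"
    using that by (metis UNIV_eq_I ex_in_conv)
  have "Us i = UNIV" "Vs i = UNIV" if "i \<in> {1..k}" for i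
    using assms(13,14)[OF that] UNIV by auto
  moreover have "U = UNIV" using assms(12) UNIV by blast
  moreover have "\<phi> (inv\<^bsub>G\<^esub> (g i n)) ` UNIV = UNIV" for i n
    by (rule UNIV) simp
  ultimately have "U \<inter> (\<Inter>i\<in>{1..k}. \<phi> (inv\<^bsub>G\<^esub> (g i n)) ` Vs i) \<noteq> {}"
    and "undefined \<in> U" for n
    by simp_all
  moreover have "(\<lambda>x. \<lambda>i\<in>{1..k}. \<phi> (inv\<^bsub>G\<^esub> (g i n)) (x i)) (\<lambda>i\<in>{1..k}. undefined) \<in> (\<Pi>\<^sub>E i\<in>{1..k}. Us i)"
    "(\<lambda>i\<in>{1..k}. undefined) \<in> (\<Pi>\<^sub>E i\<in>{1..k}. Vs i)" for n
    using \<open>\<And>i. i \<in> {1..k} \<Longrightarrow> Us i = UNIV\<close> \<open>\<And>i. i \<in> {1..k} \<Longrightarrow> Vs i = UNIV\<close> by auto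
  then have "(\<Pi>\<^sub>E i\<in>{1..k}. Us i) \<inter> (\<lambda>x. \<lambda>i\<in>{1..k}. \<phi> (inv\<^bsub>G\<^esub> (g i n)) (x i)) ` (\<Pi>\<^sub>E i\<in>{1..k}. Vs i) \<noteq> {}" for n
    by blast
  ultimately show ?thesis
    by (simp add: thickly_syndetic_UNIV syndetic_UNIV)
next
  case False
  interpret tds: topological_dynamical_system G \<tau> \<phi> by fact
  obtain s where s: "lower_central_series G s = {\<one>\<^bsub>G\<^esub>}"
    using assms(2) by (auto simp: nilpotent_group_def)
  define D where "D = Suc (Max ((\<lambda>(i, j). degree (p i j)) ` ({1..k} \<times> {1..d})))"
  have deg: "degree (p i j) < D" if "i \<in> {1..k}" "j \<in> {1..d}" for i j
    unfolding D_def less_Suc_eq_le by (rule Max_ge) (use that in auto)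
  interpret mixing_minimal_action G D s \<phi>
  proof
    show "lower_central_series G s = {\<one>\<^bsub>G\<^esub>}" by (rule s)
    show "x = \<one>\<^bsub>G\<^esub>" if "x \<in> carrier G" "x [^]\<^bsub>G\<^esub> (m::int) = \<one>\<^bsub>G\<^esub>" "m \<noteq> 0" for x m
      using torsion_imp_singleton[OF tds.group_action_axioms that(1) _ _ that(2,3)] assms(3)[OF that(1)]
        False by blast
    show "\<phi> (a \<otimes>\<^bsub>G\<^esub> b) x = \<phi> a (\<phi> b x)" if "a \<in> carrier G" "b \<in> carrier G" for a b x
      using that by (simp add: tds.composition_rule)
    show "\<phi> \<one>\<^bsub>G\<^esub> x = x" for x
      using tds.id_eq_one by (metis UNIV_I restrict_apply')
    show "continuous_on UNIV (\<phi> a)" if a: "a \<in> carrier G" for a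
    proof -
      have "continuous_map euclidean (prod_topology \<tau> euclidean) (\<lambda>x. (a, x))"
        using a by (intro continuous_map_pairedI) (auto simp: tds.topspace_eq)
      from continuous_map_compose[OF this tds.continuous_action] show ?thesis
        by (simp add: comp_def)
    qed
  qed (use tds.compact_space_UNIV assms(3) in auto)
  have g: "g i = polynomial_product G d T (p i)" if "i \<in> {1..k}" for i
    using assms(8)[OF that] by (rule ext)
  have gP: "g i \<in> plevel 0 - {\<one>\<^bsub>SG\<^esub>}" if i: "i \<in> {1..k}" for i
  proof -
    have "g i \<in> plevel 0"
      unfolding g[OF i] by (rule polynomial_product_plevel) (use assms(6,7) i deg in auto)
    moreover have "g i \<noteq> \<one>\<^bsub>SG\<^esub>"
      using assms(9)[OF i] by (auto simp: depends_nontrivially_def constant_on_def tds.one_seq_group)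
    ultimately show ?thesis by simp
  qed
  then have gc: "g i n \<in> carrier G" if "i \<in> {1..k}" for i n
    using that plevel_closed by blast
  have g_inj: "inj_on g {1..k}"
  proof (rule inj_onI, rule ccontr)
    fix i j assume ij: "i \<in> {1..k}" "j \<in> {1..k}" "g i = g j" "i \<noteq> j"
    have "(\<lambda>n. g i n \<otimes>\<^bsub>G\<^esub> inv\<^bsub>G\<^esub> (g j n)) = (\<lambda>_. \<one>\<^bsub>G\<^esub>)"
      using ij(3) gc[OF ij(2)] by simp
    then show False
      using assms(10)[OF ij(1,2,4)] by (auto simp: depends_nontrivially_def constant_on_def)
  qed
  have act_inv': "\<phi> (inv\<^bsub>G\<^esub> a) (\<phi> a x) = x" if "a \<in> carrier G" for a x
    using act_inv[of "inv\<^bsub>G\<^esub> a" x] that by simp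
  \<comment> \<open>The coordinates of a point in the product are independent, so the return times
    of the product are the common return times of the coordinates.\<close>
  have "thickly_syndetic (\<Inter>i\<in>{1..k}. {n. \<exists>x\<in>Us i. \<phi> (g i n) x \<in> Vs i})"
    using gP assms(13,14) by (intro thickly_syndetic_INT thickly_syndetic_single_returns) auto
  then have "thickly_syndetic
      {n. (\<Pi>\<^sub>E i\<in>{1..k}. Us i) \<inter>
          (\<lambda>x. \<lambda>i\<in>{1..k}. \<phi> (inv\<^bsub>G\<^esub> (g i n)) (x i)) ` (\<Pi>\<^sub>E i\<in>{1..k}. Vs i) \<noteq> {}}"
  proof (rule thickly_syndetic_mono, intro subsetI CollectI)
    fix n assume "n \<in> (\<Inter>i\<in>{1..k}. {n. \<exists>x\<in>Us i. \<phi> (g i n) x \<in> Vs i})"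
    then have "\<forall>i\<in>{1..k}. \<exists>x. x \<in> Us i \<and> \<phi> (g i n) x \<in> Vs i" by auto
    then obtain x where x: "\<And>i. i \<in> {1..k} \<Longrightarrow> x i \<in> Us i \<and> \<phi> (g i n) (x i) \<in> Vs i"
      by metis
    have "(\<lambda>i\<in>{1..k}. x i) = (\<lambda>i\<in>{1..k}. \<phi> (inv\<^bsub>G\<^esub> (g i n)) ((\<lambda>i\<in>{1..k}. \<phi> (g i n) (x i)) i))"
      using act_inv'[OF gc] by (intro restrict_ext) simp
    moreover have "(\<lambda>i\<in>{1..k}. x i) \<in> (\<Pi>\<^sub>E i\<in>{1..k}. Us i)"
      "(\<lambda>i\<in>{1..k}. \<phi> (g i n) (x i)) \<in> (\<Pi>\<^sub>E i\<in>{1..k}. Vs i)"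
      using x by auto
    ultimately show "(\<Pi>\<^sub>E i\<in>{1..k}. Us i) \<inter>
          (\<lambda>x. \<lambda>i\<in>{1..k}. \<phi> (inv\<^bsub>G\<^esub> (g i n)) (x i)) ` (\<Pi>\<^sub>E i\<in>{1..k}. Vs i) \<noteq> {}"
      by blast
  qed
  moreover have "syndetic {n. U \<inter> (\<Inter>i\<in>{1..k}. \<phi> (inv\<^bsub>G\<^esub> (g i n)) ` Vs i) \<noteq> {}}"
  proof -
    \<comment> \<open>Reindexing the targets by sequences is consistent because the
      \<open>g i\<close> are distinct.\<close>
    define V where "V f = Vs (the_inv_into {1..k} g f)" for f
    have V: "V (g i) = Vs i" if "i \<in> {1..k}" for i
      unfolding V_def using the_inv_into_f_f[OF g_inj that] by simp
    have "syndetic {n. \<exists>x\<in>U. \<forall>f\<in>g ` {1..k}. \<phi> (f n) x \<in> V f}"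
    proof (rule syndetic_multiple_returns)
      show "g ` {1..k} \<subseteq> plevel 0 - {\<one>\<^bsub>SG\<^esub>}" using gP by (rule image_subsetI)
      show "open (V f) \<and> V f \<noteq> {}" if "f \<in> g ` {1..k}" for f
        using that V assms(14) by auto
    qed (use assms(11,12) in auto)
    then show ?thesis
    proof (rule syndetic_mono, intro subsetI CollectI)
      fix n assume "n \<in> {n. \<exists>x\<in>U. \<forall>f\<in>g ` {1..k}. \<phi> (f n) x \<in> V f}"
      then obtain x where x: "x \<in> U" "\<And>i. i \<in> {1..k} \<Longrightarrow> \<phi> (g i n) x \<in> Vs i"
        using V by auto
      have "x \<in> \<phi> (inv\<^bsub>G\<^esub> (g i n)) ` Vs i" if "i \<in> {1..k}" for i
        using x(2)[OF that] act_inv'[OF gc[OF that], of n x] by (metis imageI)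
      then show "U \<inter> (\<Inter>i\<in>{1..k}. \<phi> (inv\<^bsub>G\<^esub> (g i n)) ` Vs i) \<noteq> {}"
        using x(1) by blast
    qed
  qed
  ultimately show ?thesis ..
qed

end
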